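(* Let $\mathcal U$ satisfy Assumptions A1 and A2 in the context, with $\mathcal K$ of the form given there. With the optimal values defined in the context (those with superscripts $\mathcal L,\mathcal P_1$ for problems with possibly non-fixed recourse, those with superscripts $\mathcal Q,\mathcal P_2$ for problems with fixed recourse), the following chains of inequalities hold: $$Z^{\mathcal L}\le Z^{\mathcal L}_{\mathrm{IA}}\le Z^{\mathcal L}_{\mathrm{AS}}=Z^{\mathcal P_1}_{\mathrm{SOS}}\qquad\text{and}\qquad Z^{\mathcal Q}\le Z^{\mathcal Q}_{\mathrm{IA}}\le Z^{\mathcal Q}_{\mathrm{AS}}=Z^{\mathcal P_2}_{\mathrm{SOS}}.$$
   Context: Notation: $[M]=\{1,\dots,M\}$; $\mathbf e_i$ standard basis vectors; $\mathcal S^n$ symmetric $n\times n$ matrices; $\succeq\boldsymbol 0$ positive semidefinite; $\ge\boldsymbol 0$ on matrices is componentwise. $\mathcal{SOC}(r)\subseteq\mathbb R^r$ is the second-order cone $\{\boldsymbol v:\|(v_1,\dots,v_{r-1})\|\le v_r\}$. $\mathrm{Rows}(\boldsymbol\Phi)\in\mathcal{SOC}(r)$ means every row of $\boldsymbol\Phi$, as a column vector, lies in $\mathcal{SOC}(r)$. Uncertainty set: $\mathcal K=\{\boldsymbol u\in\mathbb R^K\times\mathbb R_+:\widehat{\boldsymbol P}\boldsymbol u\ge\boldsymbol 0,\ \widehat{\boldsymbol R}\boldsymbol u\in\mathcal{SOC}(K_r)\}$ with $\widehat{\boldsymbol P}\in\mathbb R^{K_p\times(K+1)}$, $\widehat{\boldsymbol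 R}\in\mathbb R^{K_r\times(K+1)}$; $\widehat{\boldsymbol C}_i\in\mathcal S^{K+1}$, $i\in[I]$; $\mathcal U=\{\boldsymbol u\in\mathcal K:u_{K+1}=1,\ \boldsymbol u^\top\widehat{\boldsymbol C}_i\boldsymbol u=0\ \forall i\in[I]\}$; $\mathcal U^0=\{\boldsymbol u\in\mathcal K:u_{K+1}=1\}$. Assumption A1: $\mathcal U^0$ is nonempty and compact. Assumption A2: $\min_{\boldsymbol u\in\mathcal U^0}\boldsymbol u^\top\widehat{\boldsymbol C}_i\boldsymbol u=0$ for every $i$. Two-stage problem: $\inf\ \boldsymbol c^\top\boldsymbol x+\sup_{\boldsymbol u\in\mathcal U}\boldsymbol d(\boldsymbol u)^\top\boldsymbol y(\boldsymbol u)$ s.t. $\boldsymbol{\mathcal A}(\boldsymbol u)\boldsymbol x+\boldsymbol{\mathcal B}(\boldsymbol u)\boldsymbol y(\boldsymbol u)\ge\boldsymbol h(\boldsymbol u)\ \forall\boldsymbol u\in\mathcal U$, over $\boldsymbol x\in\mathcal X\subseteq\mathbb R^M$ and functions $\boldsymbol y:\mathcal U\to\mathbb R^N$, where $\boldsymbol{\mathcal A}(\boldsymbol u)=\sum_ku_k\widehat{\boldsymbol A}_k\in\mathbb R^{J\times M}$, $\boldsymbol{\mathcal B}(\boldsymbol u)=\sum_ku_k\widehat{\boldsymbol B}_k\in\mathbb R^{J\times N}$, $\boldsymbol d(\boldsymbol u)=\widehat{\boldsymbol D}\boldsymbol u$, $\boldsymbol h(\boldsymbol u)=\widehat{\boldsymbol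 H}\boldsymbol u$, $\widehat{\boldsymbol H}=(\widehat{\boldsymbol h}_1,\dots,\widehat{\boldsymbol h}_J)^\top$. Fixed recourse means $\boldsymbol d(\boldsymbol u)=\widehat{\boldsymbol d}\in\mathbb R^N$ and $\boldsymbol{\mathcal B}(\boldsymbol u)=\widehat{\boldsymbol B}=(\widehat b_{jn})$ constant on $\mathcal U$. $Z^{\mathcal L}$: optimal value when $\boldsymbol y(\boldsymbol u)=\boldsymbol Y\boldsymbol u$, $\boldsymbol Y\in\mathbb R^{N\times(K+1)}$ a decision variable. $Z^{\mathcal Q}$ (fixed recourse): optimal value when $[\boldsymbol y(\boldsymbol u)]_n=\boldsymbol u^\top\boldsymbol Q_n\boldsymbol u$, $\boldsymbol Q_n\in\mathcal S^{K+1}$ decision variables. Let $\widehat{\boldsymbol\Theta}_j$, $\widehat{\boldsymbol\Lambda}_j$ be the matrices whose $k$-th rows are $\mathbf e_j^\top\widehat{\boldsymbol A}_k$, $\mathbf e_j^\top\widehat{\boldsymbol B}_k$, $k\in[K+1]$, let $\boldsymbol\Omega_j(\boldsymbol x,\boldsymbol Y)=\frac12(\widehat{\boldsymbol\Theta}_j\boldsymbol x\mathbf e_{K+1}^\top+\mathbf e_{K+1}\boldsymbol x^\top\widehat{\boldsymbol\Theta}_j^\top+\widehat{\boldsymbol\Lambda}_j\boldsymbol Y+\boldsymbol Y^\top\widehat{\boldsymbol\Lambda}_j^\top-\widehat{\boldsymbol h}_j\mathbf e_{K+1}^\top-\mathbf e_{K+1}\widehat{\boldsymbol h}_j^\top)$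 and $\boldsymbol\Gamma_j(\boldsymbol x,\boldsymbol Q_1,\dots,\boldsymbol Q_N)=\frac12(\widehat{\boldsymbol\Theta}_j\boldsymbol x\mathbf e_{K+1}^\top+\mathbf e_{K+1}\boldsymbol x^\top\widehat{\boldsymbol\Theta}_j^\top-\mathbf e_{K+1}\widehat{\boldsymbol h}_j^\top-\widehat{\boldsymbol h}_j\mathbf e_{K+1}^\top)+\sum_n\widehat b_{jn}\boldsymbol Q_n$. For a set $\mathcal C\subseteq\mathcal S^{K+1}$ consider: (PL) $\inf\boldsymbol c^\top\boldsymbol x+\lambda$ s.t. $\lambda\mathbf e_{K+1}\mathbf e_{K+1}^\top-\frac12(\widehat{\boldsymbol D}^\top\boldsymbol Y+\boldsymbol Y^\top\widehat{\boldsymbol D})+\sum_i\alpha_i\widehat{\boldsymbol C}_i\in\mathcal C$ and $\boldsymbol\Omega_j(\boldsymbol x,\boldsymbol Y)-\pi_j\mathbf e_{K+1}\mathbf e_{K+1}^\top-\sum_i[\boldsymbol\beta_j]_i\widehat{\boldsymbol C}_i\in\mathcal C$ for all $j\in[J]$, over $\boldsymbol x\in\mathcal X$, $\lambda\in\mathbb R$, $\boldsymbol Y$, $\boldsymbol\pi\in\mathbb R^J_+$, $\boldsymbol\alpha,\boldsymbol\beta_j\in\mathbb R^I$; (PQ) $\inf\boldsymbol c^\top\boldsymbol x+\lambda$ s.t. $\lambda\mathbf e_{K+1}\mathbf e_{K+1}^\top-\sum_n\widehat d_n\boldsymbol Q_n+\sum_i\alpha_i\widehat{\boldsymbol C}_i\in\mathcal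 C$ and $\boldsymbol\Gamma_j(\boldsymbol x,\boldsymbol Q_1,\dots,\boldsymbol Q_N)-\pi_j\mathbf e_{K+1}\mathbf e_{K+1}^\top-\sum_i[\boldsymbol\beta_j]_i\widehat{\boldsymbol C}_i\in\mathcal C$ for all $j$, over $\boldsymbol x\in\mathcal X$, $\lambda\in\mathbb R$, $\boldsymbol Q_n\in\mathcal S^{K+1}$, $\boldsymbol\pi\in\mathbb R^J_+$, $\boldsymbol\alpha,\boldsymbol\beta_j\in\mathbb R^I$. $Z^{\mathcal L}_{\mathrm{IA}},Z^{\mathcal Q}_{\mathrm{IA}}$ (resp. $Z^{\mathcal L}_{\mathrm{AS}},Z^{\mathcal Q}_{\mathrm{AS}}$) are the optimal values of (PL), (PQ) with $\mathcal C=\mathcal{IA}(\mathcal K)$ (resp. $\mathcal C=\mathcal{AS}(\mathcal K)$), where with $\widehat{\boldsymbol S}=\widehat{\boldsymbol R}^\top\mathbf e_{K_r}\mathbf e_{K_r}^\top\widehat{\boldsymbol R}-\sum_{\ell=1}^{K_r-1}\widehat{\boldsymbol R}^\top\mathbf e_\ell\mathbf e_\ell^\top\widehat{\boldsymbol R}$: $\mathcal{IA}(\mathcal K)$ is the set of $\boldsymbol V=\boldsymbol W+\tau\widehat{\boldsymbol S}+\widehat{\boldsymbol P}^\top\boldsymbol\Sigma\widehat{\boldsymbol P}+\frac12(\widehat{\boldsymbol P}^\top\boldsymbol\Phi\widehat{\boldsymbol R}+\widehat{\boldsymbol R}^\top\boldsymbol\Phi^\top\widehat{\boldsymbol P})$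 with $\boldsymbol W\in\mathcal S^{K+1}$, $\boldsymbol W\succeq\boldsymbol 0$, $\tau\ge0$, $\boldsymbol\Sigma\in\mathcal S^{K_p}$, $\boldsymbol\Sigma\ge\boldsymbol 0$, $\boldsymbol\Phi\in\mathbb R^{K_p\times K_r}$, $\mathrm{Rows}(\boldsymbol\Phi)\in\mathcal{SOC}(K_r)$; $\mathcal{AS}(\mathcal K)$ is the set of $\boldsymbol V=\boldsymbol W+\tau\widehat{\boldsymbol S}+\frac12(\widehat{\boldsymbol P}^\top\boldsymbol\theta\mathbf e_{K+1}^\top+\mathbf e_{K+1}\boldsymbol\theta^\top\widehat{\boldsymbol P})$ with $\boldsymbol W\in\mathcal S^{K+1}$, $\boldsymbol W\succeq\boldsymbol 0$, $\tau\ge0$, $\boldsymbol\theta\in\mathbb R^{K_p}_+$. $Z^{\mathcal P_d}_{\mathrm{SOS}}$: restrict $\boldsymbol y$ to polynomials of degree at most $d$ in the primitive parameters $(u_1,\dots,u_K)$ (with $u_{K+1}=1$), introduce an epigraph variable $\lambda$ for the worst-case second-stage cost, and replace each requirement that a polynomial of degree $\hat d$ ($\hat d=d+1$ for non-fixed recourse, $\hat d=d$ for fixed recourse) be nonnegative on $\mathcal U$, namely $\lambda-\boldsymbol d(\boldsymbol u)^\top\boldsymbol y(\boldsymbol u)\ge0$ and $[\boldsymbol{\mathcal A}(\boldsymbol u)\boldsymbol x+\boldsymbol{\mathcal B}(\boldsymbol u)\boldsymbol y(\boldsymbol u)-\boldsymbol h(\boldsymbol u)]_j\ge0$, by the sufficient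 condition that it admit a sum-of-squares decomposition of degree $\hat d$ relative to $\mathcal U$; the optimal value of the resulting problem is $Z^{\mathcal P_d}_{\mathrm{SOS}}$. In both cases used here ($d=1$ with non-fixed recourse, $d=2$ with fixed recourse) $\hat d=2$, and such a decomposition of $p$ is an identity of polynomials in $(u_1,\dots,u_K)$ (with $u_{K+1}=1$) $p=\sigma_0+\sum_{\ell=1}^{K_p}\theta_\ell\,[\widehat{\boldsymbol P}\boldsymbol u]_\ell+\tau\,\boldsymbol u^\top\widehat{\boldsymbol S}\boldsymbol u+\sum_{i=1}^I\gamma_i\,\boldsymbol u^\top\widehat{\boldsymbol C}_i\boldsymbol u$ with $\sigma_0$ a sum of squares of degree at most $2$, $\theta_\ell\ge0$, $\tau\ge0$, $\gamma_i\in\mathbb R$.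
   Formalization: The formal theorem additionally assumes that P̂u ≥ 0 and R̂u ∈ SOC(K_r) already imply u_{K+1} ≥ 0; without it Z_IA ≤ Z_AS can fail. Under A1 this excludes only cases where U⁰ is a single point u₀ with P̂u₀ = 0 and R̂u₀ = 0. *)

theory Defs
  imports "HOL-Analysis.Analysis" "HOL-Library.Poly_Mapping"
begin

text \<open>
  Vectors of \<open>\<real>\<^sup>K\<^sup>+\<^sup>1\<close> are indexed by \<open>'k option\<close>, where \<open>CARD('k) = K\<close>: the index
  \<open>Some i\<close> stands for the primitive parameter \<open>u\<^sub>i\<close> and \<open>None\<close> for the last index \<open>K + 1\<close>.
\<close>

abbreviation last_unit :: "real ^ 'k::finite option"
  where "last_unit \<equiv> axis None 1"

definition outer :: "real ^ 'm \<Rightarrow> real ^ 'n \<Rightarrow> real ^ 'n ^ 'm"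
  where "outer v w = (\<chi> i j. v $ i * w $ j)"

definition symmetric :: "real ^ 'n ^ 'n \<Rightarrow> bool"
  where "symmetric M \<longleftrightarrow> transpose M = M"

definition psd :: "real ^ 'n ^ 'n \<Rightarrow> bool"
  where "psd M \<longleftrightarrow> symmetric M \<and> (\<forall>v. 0 \<le> v \<bullet> (M *v v))"

definition last_index :: "'r::{finite,linorder}"
  where "last_index = Max UNIV"

definition SOC :: "(real ^ 'r::{finite,linorder}) set"
  where "SOC = {v. L2_set (\<lambda>i. v $ i) (UNIV - {last_index}) \<le> v $ last_index}"

text \<open>\<open>Phat\<close>, \<open>Rhat\<close> and \<open>Chat\<close> describe the uncertainty set.\<close>

record ('k, 'p, 'r, 'i) uncertainty =
  Phat :: "real ^ ('k::finite option) ^ ('p::finite)"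
  Rhat :: "real ^ ('k::finite option) ^ ('r::{finite,linorder})"
  Chat :: "'i::finite \<Rightarrow> real ^ ('k::finite option) ^ ('k option)"

definition cone_K ::
  "('k::finite, 'p::finite, 'r::{finite,linorder}, 'i::finite) uncertainty \<Rightarrow> (real ^ 'k option) set"
  where "cone_K U = {u. 0 \<le> u $ None \<and> (\<forall>l. 0 \<le> (Phat U *v u) $ l) \<and> Rhat U *v u \<in> SOC}"

definition uset ::
  "('k::finite, 'p::finite, 'r::{finite,linorder}, 'i::finite) uncertainty \<Rightarrow> (real ^ 'k option) set"
  where "uset U = {u \<in> cone_K U. u $ None = 1 \<and> (\<forall>i. u \<bullet> (Chat U i *v u) = 0)}"

definition uset0 ::
  "('k::finite, 'p::finite, 'r::{finite,linorder}, 'i::finite) uncertainty \<Rightarrow> (real ^ 'k option) set"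
  where "uset0 U = {u \<in> cone_K U. u $ None = 1}"

definition assumption_A1 ::
  "('k::finite, 'p::finite, 'r::{finite,linorder}, 'i::finite) uncertainty \<Rightarrow> bool"
  where "assumption_A1 U \<longleftrightarrow> uset0 U \<noteq> {} \<and> compact (uset0 U)"

text \<open>The minimum of each quadratic form over \<open>uset0 U\<close> is attained and equals 0.\<close>

definition assumption_A2 ::
  "('k::finite, 'p::finite, 'r::{finite,linorder}, 'i::finite) uncertainty \<Rightarrow> bool"
  where "assumption_A2 U \<longleftrightarrow>
    (\<forall>i. (\<exists>u \<in> uset0 U. u \<bullet> (Chat U i *v u) = 0) \<and>
         (\<forall>u \<in> uset0 U. 0 \<le> u \<bullet> (Chat U i *v u)))"

text \<open>
  Data of the two-stage problem. The coefficient functions are linear in \<open>u\<close>; the vector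
  \<open>h\<^sub>j\<close> is row \<open>j\<close> of \<open>Hhat\<close>.
\<close>

record ('k, 'm, 'n, 'j) two_stage =
  feas :: "(real ^ ('m::finite)) set"
  cost :: "real ^ ('m::finite)"
  Ahat :: "'k::finite option \<Rightarrow> real ^ ('m::finite) ^ ('j::finite)"
  Bhat :: "'k::finite option \<Rightarrow> real ^ ('n::finite) ^ ('j::finite)"
  Dhat :: "real ^ ('k::finite option) ^ ('n::finite)"
  Hhat :: "real ^ ('k::finite option) ^ ('j::finite)"

definition Afun ::
  "('k::finite, 'm::finite, 'n::finite, 'j::finite) two_stage \<Rightarrow> real ^ 'k option \<Rightarrow> real ^ 'm ^ 'j"
  where "Afun T u = (\<Sum>k\<in>UNIV. u $ k *\<^sub>R Ahat T k)"

definition Bfun ::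
  "('k::finite, 'm::finite, 'n::finite, 'j::finite) two_stage \<Rightarrow> real ^ 'k option \<Rightarrow> real ^ 'n ^ 'j"
  where "Bfun T u = (\<Sum>k\<in>UNIV. u $ k *\<^sub>R Bhat T k)"

definition dfun ::
  "('k::finite, 'm::finite, 'n::finite, 'j::finite) two_stage \<Rightarrow> real ^ 'k option \<Rightarrow> real ^ 'n"
  where "dfun T u = Dhat T *v u"

definition hfun ::
  "('k::finite, 'm::finite, 'n::finite, 'j::finite) two_stage \<Rightarrow> real ^ 'k option \<Rightarrow> real ^ 'j"
  where "hfun T u = Hhat T *v u"

definition fixed_recourse ::
  "('k::finite, 'p::finite, 'r::{finite,linorder}, 'i::finite) uncertainty \<Rightarrow>
   ('k, 'm::finite, 'n::finite, 'j::finite) two_stage \<Rightarrow> real ^ 'n \<Rightarrow> real ^ 'n ^ 'j \<Rightarrow> bool"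
  where "fixed_recourse U T d B \<longleftrightarrow> (\<forall>u \<in> uset U. dfun T u = d \<and> Bfun T u = B)"

text \<open>
  Optimal values are extended reals, with value \<open>\<infinity>\<close> for infeasible problems.
  \<open>policy_value U T \<Y>\<close> is the value of the two-stage problem with the second-stage
  decision rules restricted to the class \<open>\<Y>\<close>.
\<close>

definition policy_value ::
  "('k::finite, 'p::finite, 'r::{finite,linorder}, 'i::finite) uncertainty \<Rightarrow>
   ('k, 'm::finite, 'n::finite, 'j::finite) two_stage \<Rightarrow>
   (real ^ 'k option \<Rightarrow> real ^ 'n) set \<Rightarrow> ereal"
  where "policy_value U T \<Y> =
    Inf {ereal (cost T \<bullet> x) + (SUP u\<in>uset U. ereal (dfun T u \<bullet> y u)) | x y.
      x \<in> feas T \<and> y \<in> \<Y> \<and>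
      (\<forall>u \<in> uset U. \<forall>j. hfun T u $ j \<le> (Afun T u *v x + Bfun T u *v y u) $ j)}"

definition linear_policies :: "(real ^ 'k::finite option \<Rightarrow> real ^ 'n::finite) set"
  where "linear_policies = {\<lambda>u. Y *v u | Y. True}"

definition quadratic_policies :: "(real ^ 'k::finite option \<Rightarrow> real ^ 'n::finite) set"
  where "quadratic_policies = {\<lambda>u. \<chi> n. u \<bullet> (Q n *v u) | Q. \<forall>n. symmetric (Q n)}"

definition Z_L ::
  "('k::finite, 'p::finite, 'r::{finite,linorder}, 'i::finite) uncertainty \<Rightarrow>
   ('k, 'm::finite, 'n::finite, 'j::finite) two_stage \<Rightarrow> ereal"
  where "Z_L U T = policy_value U T linear_policies"

definition Z_Q ::
  "('k::finite, 'p::finite, 'r::{finite,linorder}, 'i::finite) uncertainty \<Rightarrow>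
   ('k, 'm::finite, 'n::finite, 'j::finite) two_stage \<Rightarrow> ereal"
  where "Z_Q U T = policy_value U T quadratic_policies"

definition Theta ::
  "('k::finite, 'm::finite, 'n::finite, 'j::finite) two_stage \<Rightarrow> 'j \<Rightarrow> real ^ 'm ^ 'k option"
  where "Theta T j = (\<chi> k. Ahat T k $ j)"

definition Lambda ::
  "('k::finite, 'm::finite, 'n::finite, 'j::finite) two_stage \<Rightarrow> 'j \<Rightarrow> real ^ 'n ^ 'k option"
  where "Lambda T j = (\<chi> k. Bhat T k $ j)"

definition Omega ::
  "('k::finite, 'm::finite, 'n::finite, 'j::finite) two_stage \<Rightarrow> 'j \<Rightarrow>
   real ^ 'm \<Rightarrow> real ^ 'k option ^ 'n \<Rightarrow> real ^ 'k option ^ 'k option"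
  where "Omega T j x Y = (1/2) *\<^sub>R
    (outer (Theta T j *v x) last_unit + outer last_unit (Theta T j *v x)
     + Lambda T j ** Y + transpose Y ** transpose (Lambda T j)
     - outer (Hhat T $ j) last_unit - outer last_unit (Hhat T $ j))"

definition Gamma ::
  "('k::finite, 'm::finite, 'n::finite, 'j::finite) two_stage \<Rightarrow> real ^ 'n ^ 'j \<Rightarrow> 'j \<Rightarrow>
   real ^ 'm \<Rightarrow> ('n \<Rightarrow> real ^ 'k option ^ 'k option) \<Rightarrow> real ^ 'k option ^ 'k option"
  where "Gamma T B j x Q = (1/2) *\<^sub>R
    (outer (Theta T j *v x) last_unit + outer last_unit (Theta T j *v x)
     - outer last_unit (Hhat T $ j) - outer (Hhat T $ j) last_unit)
     + (\<Sum>n\<in>UNIV. B $ j $ n *\<^sub>R Q n)"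

definition PL_value ::
  "('k::finite, 'p::finite, 'r::{finite,linorder}, 'i::finite) uncertainty \<Rightarrow>
   ('k, 'm::finite, 'n::finite, 'j::finite) two_stage \<Rightarrow>
   (real ^ 'k option ^ 'k option) set \<Rightarrow> ereal"
  where "PL_value U T \<C> =
    Inf {ereal (cost T \<bullet> x + lam) | x lam (Y :: real ^ 'k option ^ 'n) \<pi> \<alpha> \<beta>.
      x \<in> feas T \<and> (\<forall>j. 0 \<le> \<pi> j) \<and>
      lam *\<^sub>R outer last_unit last_unit
        - (1/2) *\<^sub>R (transpose (Dhat T) ** Y + transpose Y ** Dhat T)
        + (\<Sum>i\<in>UNIV. \<alpha> i *\<^sub>R Chat U i) \<in> \<C> \<and>
      (\<forall>j. Omega T j x Y - \<pi> j *\<^sub>R outer last_unit last_unit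
        - (\<Sum>i\<in>UNIV. \<beta> j i *\<^sub>R Chat U i) \<in> \<C>)}"

definition PQ_value ::
  "('k::finite, 'p::finite, 'r::{finite,linorder}, 'i::finite) uncertainty \<Rightarrow>
   ('k, 'm::finite, 'n::finite, 'j::finite) two_stage \<Rightarrow> real ^ 'n \<Rightarrow> real ^ 'n ^ 'j \<Rightarrow>
   (real ^ 'k option ^ 'k option) set \<Rightarrow> ereal"
  where "PQ_value U T d B \<C> =
    Inf {ereal (cost T \<bullet> x + lam) | x lam Q \<pi> \<alpha> \<beta>.
      x \<in> feas T \<and> (\<forall>n. symmetric (Q n)) \<and> (\<forall>j. 0 \<le> \<pi> j) \<and>
      lam *\<^sub>R outer last_unit last_unit
        - (\<Sum>n\<in>UNIV. d $ n *\<^sub>R Q n)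
        + (\<Sum>i\<in>UNIV. \<alpha> i *\<^sub>R Chat U i) \<in> \<C> \<and>
      (\<forall>j. Gamma T B j x Q - \<pi> j *\<^sub>R outer last_unit last_unit
        - (\<Sum>i\<in>UNIV. \<beta> j i *\<^sub>R Chat U i) \<in> \<C>)}"

definition Shat ::
  "('k::finite, 'p::finite, 'r::{finite,linorder}, 'i::finite) uncertainty \<Rightarrow>
   real ^ 'k option ^ 'k option"
  where "Shat U =
    outer (transpose (Rhat U) *v axis last_index 1) (transpose (Rhat U) *v axis last_index 1)
    - (\<Sum>l\<in>UNIV - {last_index}.
        outer (transpose (Rhat U) *v axis l 1) (transpose (Rhat U) *v axis l 1))"

text \<open>
  Pitfall: the two cones below are generated by \<open>Phat\<close> and \<open>Rhat\<close> only; the sign constraint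
  \<open>0 \<le> u $ None\<close> of \<open>cone_K\<close> contributes no generator. Hence \<open>AS_cone U \<subseteq> IA_cone U\<close>
  can fail if that constraint is not implied by the other two.
\<close>

definition IA_cone ::
  "('k::finite, 'p::finite, 'r::{finite,linorder}, 'i::finite) uncertainty \<Rightarrow>
   (real ^ 'k option ^ 'k option) set"
  where "IA_cone U =
    {W + \<tau> *\<^sub>R Shat U + transpose (Phat U) ** \<Sigma> ** Phat U
       + (1/2) *\<^sub>R (transpose (Phat U) ** \<Phi> ** Rhat U
           + transpose (Rhat U) ** transpose \<Phi> ** Phat U)
     | W \<tau> \<Sigma> \<Phi>.
       psd W \<and> 0 \<le> \<tau> \<and> symmetric \<Sigma> \<and> (\<forall>l m. 0 \<le> \<Sigma> $ l $ m) \<and> (\<forall>l. \<Phi> $ l \<in> SOC)}"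

definition AS_cone ::
  "('k::finite, 'p::finite, 'r::{finite,linorder}, 'i::finite) uncertainty \<Rightarrow>
   (real ^ 'k option ^ 'k option) set"
  where "AS_cone U =
    {W + \<tau> *\<^sub>R Shat U
       + (1/2) *\<^sub>R (outer (transpose (Phat U) *v \<theta>) last_unit
           + outer last_unit (transpose (Phat U) *v \<theta>))
     | W \<tau> \<theta>. psd W \<and> 0 \<le> \<tau> \<and> (\<forall>l. 0 \<le> \<theta> $ l)}"

text \<open>
  Real polynomials in the primitive parameters: a polynomial maps each monomial
  (an exponent vector \<open>'k \<Rightarrow>\<^sub>0 nat\<close>) to its coefficient, and the ring multiplication of
  \<open>poly_mapping\<close> is polynomial multiplication.
\<close>

type_synonym 'k polynomial = "('k \<Rightarrow>\<^sub>0 nat) \<Rightarrow>\<^sub>0 real"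

definition Const :: "real \<Rightarrow> 'k polynomial"
  where "Const a = Poly_Mapping.single 0 a"

definition Var :: "'k \<Rightarrow> 'k polynomial"
  where "Var i = Poly_Mapping.single (Poly_Mapping.single i 1) 1"

definition degree_le :: "nat \<Rightarrow> ('k::finite) polynomial \<Rightarrow> bool"
  where "degree_le d p \<longleftrightarrow>
    (\<forall>m \<in> Poly_Mapping.keys p. (\<Sum>i\<in>UNIV. Poly_Mapping.lookup m i) \<le> d)"

definition sum_of_squares :: "'k polynomial \<Rightarrow> bool"
  where "sum_of_squares p \<longleftrightarrow> (\<exists>qs. p = (\<Sum>q\<leftarrow>qs. q ^ 2))"

text \<open>The coordinates of \<open>u\<close> as polynomials in the primitive parameters, with \<open>u\<^sub>K\<^sub>+\<^sub>1 = 1\<close>.\<close>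

definition coord :: "'k option \<Rightarrow> 'k polynomial"
  where "coord k = (case k of None \<Rightarrow> 1 | Some i \<Rightarrow> Var i)"

definition lin_poly :: "real ^ 'k::finite option \<Rightarrow> 'k polynomial"
  where "lin_poly a = (\<Sum>k\<in>UNIV. Const (a $ k) * coord k)"

definition quad_poly :: "real ^ 'k::finite option ^ 'k option \<Rightarrow> 'k polynomial"
  where "quad_poly M = (\<Sum>k\<in>UNIV. \<Sum>l\<in>UNIV. Const (M $ k $ l) * coord k * coord l)"

text \<open>
  Degree-2 sum-of-squares decomposition relative to \<open>uset U\<close>.
\<close>

definition SOS2 ::
  "('k::finite, 'p::finite, 'r::{finite,linorder}, 'i::finite) uncertainty \<Rightarrow>
   'k polynomial \<Rightarrow> bool"
  where "SOS2 U p \<longleftrightarrow>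
    (\<exists>\<sigma>\<^sub>0 (\<theta> :: 'p \<Rightarrow> real) \<tau> (\<gamma> :: 'i \<Rightarrow> real).
       sum_of_squares \<sigma>\<^sub>0 \<and> degree_le 2 \<sigma>\<^sub>0 \<and> (\<forall>l. 0 \<le> \<theta> l) \<and> 0 \<le> \<tau> \<and>
       p = \<sigma>\<^sub>0 + (\<Sum>l\<in>UNIV. Const (\<theta> l) * lin_poly (Phat U $ l))
           + Const \<tau> * quad_poly (Shat U)
           + (\<Sum>i\<in>UNIV. Const (\<gamma> i) * quad_poly (Chat U i)))"

text \<open>Row \<open>j\<close> of \<open>\<A>(u)x - h(u)\<close> as a polynomial.\<close>

definition first_stage_poly ::
  "('k::finite, 'm::finite, 'n::finite, 'j::finite) two_stage \<Rightarrow> real ^ 'm \<Rightarrow> 'j \<Rightarrow> 'k polynomial"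
  where "first_stage_poly T x j =
    (\<Sum>m\<in>UNIV. lin_poly (\<chi> k. Ahat T k $ j $ m) * Const (x $ m)) - lin_poly (Hhat T $ j)"

definition Z_SOS_P1 ::
  "('k::finite, 'p::finite, 'r::{finite,linorder}, 'i::finite) uncertainty \<Rightarrow>
   ('k, 'm::finite, 'n::finite, 'j::finite) two_stage \<Rightarrow> ereal"
  where "Z_SOS_P1 U T =
    Inf {ereal (cost T \<bullet> x + lam) | x lam y.
      x \<in> feas T \<and> (\<forall>n. degree_le 1 (y n)) \<and>
      SOS2 U (Const lam - (\<Sum>n\<in>UNIV. lin_poly (Dhat T $ n) * y n)) \<and>
      (\<forall>j. SOS2 U (first_stage_poly T x j
              + (\<Sum>n\<in>UNIV. lin_poly (\<chi> k. Bhat T k $ j $ n) * y n)))}"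

definition Z_SOS_P2 ::
  "('k::finite, 'p::finite, 'r::{finite,linorder}, 'i::finite) uncertainty \<Rightarrow>
   ('k, 'm::finite, 'n::finite, 'j::finite) two_stage \<Rightarrow> real ^ 'n \<Rightarrow> real ^ 'n ^ 'j \<Rightarrow> ereal"
  where "Z_SOS_P2 U T d B =
    Inf {ereal (cost T \<bullet> x + lam) | x lam y.
      x \<in> feas T \<and> (\<forall>n. degree_le 2 (y n)) \<and>
      SOS2 U (Const lam - (\<Sum>n\<in>UNIV. Const (d $ n) * y n)) \<and>
      (\<forall>j. SOS2 U (first_stage_poly T x j + (\<Sum>n\<in>UNIV. Const (B $ j $ n) * y n)))}"

end

theory Submission
  imports Defs
begin

text \<open>
  A matrix of the inner approximation is copositive on the cone, so a feasible point of the conic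
  program is a feasible decision rule; this gives the first inequality of each chain. For the
  second, \<open>e = P\<^sup>T a + R\<^sup>T b\<close> with \<open>a \<ge> 0\<close> and \<open>b\<close> in the second-order cone: otherwise a hyperplane
  separates \<open>e\<close> from the cone of all such sums, and its normal is a nonzero direction of recession
  of the compact set \<open>\<U>\<^sup>0\<close>. The equalities hold because quadratic polynomials in the primitive
  parameters correspond to symmetric matrices, sums of squares among them to positive
  semidefinite ones, and the slacks \<open>\<pi>\<^sub>j e e\<^sup>T\<close> can be absorbed into the semidefinite part.
\<close>

section \<open>Quadratic forms and semidefinite matrices\<close>

text \<open>The second inequality shapes the hypotheses. \<open>IA_cone\<close> is generated by
  \<open>Phat\<close> and \<open>Rhat\<close> alone, whereas \<open>AS_cone\<close> multiplies
  \<open>Phat\<close> by the last unit vector. The sign constraint on the last coordinate must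
  therefore follow from the other two constraints, which is what \<open>last_nonneg\<close> states.
  In the first inequality the multipliers of \<open>Chat\<close> may have any sign because these
  forms vanish on \<open>uset\<close>. In the equalities, inhomogeneous polynomials in K variables
  meet homogeneous forms in K+1 variables. The bridge is evaluation on the slice where the last
  coordinate is 1: it determines a symmetric matrix, so polynomial identities are settled without
  comparing coefficients.\<close>

lemma outer_mult_vector: "outer v w *v u = (w \<bullet> u) *\<^sub>R v"
  by (simp add: outer_def matrix_vector_mult_def vec_eq_iff inner_vec_def sum_distrib_left mult_ac)

lemma inner_sum_matrix: "u \<bullet> (sum M I *v w) = (\<Sum>i\<in>I. u \<bullet> (M i *v w))"
  by (induction I rule: infinite_finite_induct)
    (simp_all add: matrix_vector_mult_add_rdistrib inner_add_right)

lemma inner_scaleR_matrix: "u \<bullet> ((c *\<^sub>R M) *v w) = c * (u \<bullet> (M *v w))"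
  for M :: "real ^ 'm ^ 'n"
  by (simp flip: scaleR_matrix_vector_assoc)

lemma inner_transpose_matrix: "u \<bullet> (transpose M *v w) = w \<bullet> (M *v u)"
  for M :: "real ^ 'm ^ 'n"
  by (metis dot_lmul_matrix inner_commute transpose_matrix_vector)

lemma inner_matrix_product: "u \<bullet> ((M ** N) *v w) = u \<bullet> (M *v (N *v w))"
  for M :: "real ^ 'm ^ 'n"
  by (simp add: matrix_vector_mul_assoc)

lemma inner_outer: "u \<bullet> (outer v w *v z) = (v \<bullet> u) * (w \<bullet> z)"
  by (simp add: outer_mult_vector inner_commute)

lemma inner_add_matrix: "u \<bullet> ((M + N) *v w) = u \<bullet> (M *v w) + u \<bullet> (N *v w)"
  for M :: "real ^ 'm ^ 'n"
  by (simp add: matrix_vector_mult_add_rdistrib inner_add_right)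

lemma inner_diff_matrix: "u \<bullet> ((M - N) *v w) = u \<bullet> (M *v w) - u \<bullet> (N *v w)"
  for M :: "real ^ 'm ^ 'n"
  by (simp add: matrix_vector_mult_diff_rdistrib inner_diff_right)

lemmas bilinear_simps = inner_sum_matrix inner_scaleR_matrix inner_transpose_matrix
  inner_matrix_product inner_outer inner_add_matrix inner_diff_matrix

lemma inner_transpose_vector: "(transpose M *v v) \<bullet> u = v \<bullet> (M *v u)"
  for M :: "real ^ 'm ^ 'n"
  by (simp add: dot_lmul_matrix)

lemma symmetric_iff: "symmetric M \<longleftrightarrow> (\<forall>i j. M $ i $ j = M $ j $ i)"
  by (auto simp: symmetric_def transpose_def vec_eq_iff)

lemma symmetric_add: "symmetric M \<Longrightarrow> symmetric N \<Longrightarrow> symmetric (M + N)"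
  and symmetric_diff: "symmetric M \<Longrightarrow> symmetric N \<Longrightarrow> symmetric (M - N)"
  and symmetric_scaleR: "symmetric M \<Longrightarrow> symmetric (c *\<^sub>R M)"
  and symmetric_sum: "(\<And>i. i \<in> I \<Longrightarrow> symmetric (A i)) \<Longrightarrow> symmetric (sum A I)"
  by (simp_all add: symmetric_iff)

lemma symmetric_outer: "symmetric (outer v v)"
  by (simp add: symmetric_iff outer_def)

lemma symmetric_add_transpose: "symmetric (M + transpose M)"
  by (simp add: symmetric_iff transpose_def)

lemma transpose_outer: "transpose (outer v w) = outer w v"
  by (simp add: transpose_def outer_def vec_eq_iff)

lemma psd_add: "psd M \<Longrightarrow> psd N \<Longrightarrow> psd (M + N)"
  by (simp add: psd_def symmetric_add inner_add_matrix)

lemma psd_scaleR: "0 \<le> c \<Longrightarrow> psd M \<Longrightarrow> psd (c *\<^sub>R M)"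
  by (simp add: psd_def symmetric_scaleR inner_scaleR_matrix)

lemma psd_outer: "psd (outer v v)"
  by (simp add: psd_def symmetric_outer inner_outer)

text \<open>Polarisation: expanding the form at v + w leaves twice the bilinear value, as symmetry
  makes the two mixed terms equal. Testing M w against itself then kills every image.\<close>

lemma quadratic_determines_symmetric:
  assumes "symmetric M" and "\<And>u. u \<bullet> (M *v u) = 0"
  shows "M = 0"
proof -
  have bil: "v \<bullet> (M *v w) = 0" for v w
  proof -
    have "w \<bullet> (M *v v) = v \<bullet> (M *v w)"
      using assms(1) inner_transpose_matrix[of v M w] by (simp add: symmetric_def del: transpose_matrix_vector)
    then show ?thesis
      using assms(2)[of "v + w"] assms(2)[of v] assms(2)[of w]
      by (simp add: matrix_vector_right_distrib inner_add_left inner_add_right)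
  qed
  have "M *v w = 0" for w using bil[of "M *v w" w] by simp
  then show ?thesis by (simp add: matrix_eq)
qed

text \<open>Nonnegativity on the slice \<open>u\<^sub>K\<^sub>+\<^sub>1 = 1\<close> extends to \<open>u\<^sub>K\<^sub>+\<^sub>1 \<noteq> 0\<close> by homogeneity and
  then to all vectors by continuity.\<close>

lemma nonneg_slice_imp_nonneg:
  fixes M :: "real ^ 'k::finite option ^ 'k option"
  assumes slice: "\<And>u. u $ None = 1 \<Longrightarrow> 0 \<le> u \<bullet> (M *v u)"
  shows "0 \<le> u \<bullet> (M *v u)"
proof -
  have nz: "0 \<le> v \<bullet> (M *v v)" if "v $ None \<noteq> 0" for v
  proof -
    define w where "w = (1 / v $ None) *\<^sub>R v"
    have v: "v = v $ None *\<^sub>R w" using that by (simp add: w_def)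
    have "0 \<le> w \<bullet> (M *v w)" by (rule slice) (simp add: w_def that)
    moreover have "v \<bullet> (M *v v) = (v $ None)\<^sup>2 * (w \<bullet> (M *v w))"
      by (subst (1 2) v) (simp add: matrix_vector_mult_scaleR power2_eq_square)
    ultimately show ?thesis by simp
  qed
  show ?thesis
  proof (cases "u $ None = 0")
    case True
    \<comment> \<open>Along the last axis the last entry becomes t > 0, where \<open>nz\<close>
      applies; the form at u is the limit for t tending to 0 from the right.\<close>
    let ?v = "\<lambda>t. u + t *\<^sub>R (last_unit :: real ^ 'k option)"
    have "((\<lambda>t. ?v t \<bullet> (M *v ?v t)) \<longlongrightarrow> ?v 0 \<bullet> (M *v ?v 0)) (at_right 0)"
      by (intro tendsto_intros bounded_linear.tendsto[OF matrix_vector_mul_bounded_linear])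
    moreover have "\<forall>\<^sub>F t in at_right (0::real). 0 \<le> ?v t \<bullet> (M *v ?v t)"
      unfolding eventually_at_right_field using True
      by (intro exI[of _ 1]) (auto intro!: nz)
    ultimately have "0 \<le> ?v 0 \<bullet> (M *v ?v 0)"
      by (rule tendsto_lowerbound) simp
    then show ?thesis by simp
  qed (rule nz)
qed

text \<open>The forms of M - N and N - M vanish on the slice, so both are nonnegative everywhere;
  the two signs leave only zero.\<close>

lemma symmetric_eqI:
  fixes M N :: "real ^ 'k::finite option ^ 'k option"
  assumes "symmetric M" "symmetric N"
    and "\<And>u. u $ None = 1 \<Longrightarrow> u \<bullet> (M *v u) = u \<bullet> (N *v u)"
  shows "M = N"
proof -
  have "0 \<le> u \<bullet> ((M - N) *v u)" "0 \<le> u \<bullet> ((N - M) *v u)" for u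
    by (rule nonneg_slice_imp_nonneg, simp add: inner_diff_matrix assms(3))+
  then have "u \<bullet> ((M - N) *v u) = 0" for u
    by (simp add: inner_diff_matrix order_antisym)
  then have "M - N = 0"
    by (intro quadratic_determines_symmetric symmetric_diff assms(1,2))
  then show ?thesis by simp
qed

text \<open>Outer-product Cholesky decomposition, eliminating one index of the support at a time.\<close>

lemma psd_eq_sum_outer_support:
  assumes "finite S" "psd W" "\<And>i j. i \<notin> S \<Longrightarrow> W $ i $ j = 0"
  shows "\<exists>ws. W = (\<Sum>w\<leftarrow>ws. outer w w)"
  using assms
proof (induction S arbitrary: W rule: finite_induct)
  case empty
  then have "W = (\<Sum>w\<leftarrow>[]. outer w w)" by (simp add: vec_eq_iff)
  then show ?case by blast
next
  case (insert a S)
  let ?d = "W $ a $ a" and ?e = "axis a (1::real)"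
  have sym: "W $ i $ j = W $ j $ i" for i j
    using insert.prems(1) by (simp add: psd_def symmetric_iff)
  \<comment> \<open>The form at v + t e_a as a quadratic in t; the inequalities below are instances
    at suitable t.\<close>
  have expand: "0 \<le> v \<bullet> (W *v v) + 2 * t * (W *v v) $ a + t\<^sup>2 * ?d" for v t
  proof -
    have "v \<bullet> (W *v ?e) = (W *v v) $ a"
      by (subst matrix_vector_mult_basis)
        (simp add: column_def inner_vec_def matrix_vector_mult_def sym[of _ a] mult.commute)
    moreover have "?e \<bullet> (W *v ?e) = ?d"
      by (simp add: matrix_vector_mult_basis column_def inner_axis')
    moreover have "0 \<le> (v + t *\<^sub>R ?e) \<bullet> (W *v (v + t *\<^sub>R ?e))"
      using insert.prems(1) by (simp add: psd_def)
    ultimately show ?thesis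
      by (simp add: matrix_vector_right_distrib matrix_vector_mult_scaleR inner_add_left inner_add_right
          inner_axis' power2_eq_square algebra_simps)
  qed
  have d: "0 \<le> ?d" using expand[of 0 1] by simp
  \<comment> \<open>For a zero pivot division yields 0, so \<open>w\<close> is the zero vector and
    \<open>V\<close> equals \<open>W\<close>, whose row a vanishes by \<open>row0\<close>.\<close>
  define w where "w = (1 / sqrt ?d) *\<^sub>R (W $ a)"
  define V where "V = W - outer w w"
  have row0: "W $ a $ j = 0" if "?d = 0" for j
  proof (rule ccontr)
    assume "W $ a $ j \<noteq> 0"
    moreover have "(W *v axis j 1) $ a = W $ a $ j"
      by (simp add: matrix_vector_mult_basis column_def)
    \<comment> \<open>The quadratic term of \<open>expand\<close> vanishes with the pivot, and this
      t is chosen to make the remaining value -1.\<close>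
    ultimately show False
      using expand[of "axis j 1" "- (axis j 1 \<bullet> (W *v axis j 1) + 1) / (2 * W $ a $ j)"] that
      by (simp add: field_simps)
  qed
  have w: "w $ i * w $ j = W $ a $ i * W $ a $ j / ?d" for i j
    using d by (simp add: w_def)
  have "psd V"
    unfolding psd_def
  proof
    show "symmetric V"
      unfolding V_def using insert.prems(1) by (simp add: symmetric_diff symmetric_outer psd_def)
    show "\<forall>v. 0 \<le> v \<bullet> (V *v v)"
    proof
      fix v
      have "(w \<bullet> v)\<^sup>2 = ((W *v v) $ a)\<^sup>2 / ?d"
        using d by (simp add: w_def matrix_mult_dot power_divide)
      then have "v \<bullet> (V *v v) = v \<bullet> (W *v v) - ((W *v v) $ a)\<^sup>2 / ?d"
        by (simp add: V_def inner_diff_matrix inner_outer flip: power2_eq_square)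
      \<comment> \<open>For d > 0 this t minimises the quadratic of \<open>expand\<close>, and the
        minimum is the form of the Schur complement; for d = 0 the quotient is 0 and both sides are
        the form of W.\<close>
      also have "\<dots> = v \<bullet> (W *v v) + 2 * (- (W *v v) $ a / ?d) * (W *v v) $ a + (- (W *v v) $ a / ?d)\<^sup>2 * ?d"
        by (cases "?d = 0") (simp_all add: power2_eq_square field_simps)
      finally show "0 \<le> v \<bullet> (V *v v)" using expand[of v "- (W *v v) $ a / ?d"] by simp
    qed
  qed
  moreover have "V $ i $ j = 0" if "i \<notin> S" for i j
  proof (cases "i = a")
    case True
    then show ?thesis
      by (cases "?d = 0") (simp_all add: V_def outer_def w row0)
  next
    case False
    then have "W $ i $ k = 0" for k using insert.prems(2) that by simp
    then show ?thesis by (simp add: V_def outer_def w sym[of a i])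
  qed
  ultimately obtain ws where "V = (\<Sum>w\<leftarrow>ws. outer w w)"
    using insert.IH by blast
  then have "W = (\<Sum>w\<leftarrow>w # ws. outer w w)" by (simp add: V_def algebra_simps)
  then show ?case by blast
qed

lemma psd_eq_sum_outer:
  assumes "psd W"
  obtains ws where "W = (\<Sum>w\<leftarrow>ws. outer w w)"
  using psd_eq_sum_outer_support[of UNIV W] assms by auto

text \<open>The coefficient matrix of a quadratic polynomial is not unique; the symmetric part is
  the representative determined by the form.\<close>

definition sym_part :: "real ^ 'n ^ 'n \<Rightarrow> real ^ 'n ^ 'n"
  where "sym_part M = (1/2) *\<^sub>R (M + transpose M)"

lemma symmetric_sym_part: "symmetric (sym_part M)"
  by (simp add: sym_part_def symmetric_scaleR symmetric_add_transpose)

section \<open>The conic approximations\<close>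

text \<open>Cauchy-Schwarz on the coordinates other than the last gives one direction, a reflected
  test vector the other. The dual description makes closure under sums and scaling immediate, and it
  recognises the normal of a separating hyperplane as satisfying the cone constraint.\<close>

lemma SOC_self_dual:
  fixes v :: "real ^ 'r::{finite,linorder}"
  shows "v \<in> SOC \<longleftrightarrow> (\<forall>w\<in>SOC. 0 \<le> v \<bullet> w)"
proof -
  let ?l = "last_index :: 'r" and ?I = "UNIV - {last_index :: 'r}"
  have split: "x \<bullet> y = x $ ?l * y $ ?l + (\<Sum>i\<in>?I. x $ i * y $ i)" for x y :: "(real, 'r) vec"
    by (simp add: inner_vec_def sum.remove[of UNIV ?l])
  show ?thesis
  proof (intro iffI ballI)
    fix w :: "(real, 'r) vec" assume v: "v \<in> SOC" and w: "w \<in> SOC"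
    have "- (\<Sum>i\<in>?I. v $ i * w $ i) \<le> (\<Sum>i\<in>?I. \<bar>v $ i\<bar> * \<bar>w $ i\<bar>)"
      unfolding sum_negf[symmetric] by (intro sum_mono) (metis abs_ge_minus_self abs_mult)
    also have "\<dots> \<le> L2_set (($) v) ?I * L2_set (($) w) ?I"
      by (rule L2_set_mult_ineq)
    also have "\<dots> \<le> v $ ?l * w $ ?l"
      using v w by (intro mult_mono) (auto simp: SOC_def intro: order_trans[OF L2_set_nonneg])
    finally show "0 \<le> v \<bullet> w" unfolding split by linarith
  next
    assume dual: "\<forall>w\<in>SOC. 0 \<le> v \<bullet> w"
    define n where "n = L2_set (($) v) ?I"
    \<comment> \<open>Negating all coordinates but the last, and setting the last to their norm n,
      gives a boundary point of the cone whose product with v is n (v_last - n).\<close>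
    define w :: "(real, 'r) vec" where "w = (\<chi> i. if i = ?l then n else - v $ i)"
    have "L2_set (($) w) ?I = n"
      unfolding n_def L2_set_def w_def by (intro arg_cong[where f=sqrt] sum.cong) auto
    then have "w \<in> SOC" by (simp add: SOC_def w_def)
    then have "0 \<le> v \<bullet> w" using dual by blast
    moreover have "v \<bullet> w = v $ ?l * n - (\<Sum>i\<in>?I. (v $ i)\<^sup>2)"
      unfolding split w_def by (simp add: power2_eq_square sum_negf)
    moreover have "(\<Sum>i\<in>?I. (v $ i)\<^sup>2) = n\<^sup>2"
      unfolding n_def L2_set_def by (simp add: sum_nonneg)
    ultimately have *: "0 \<le> n * (v $ ?l - n)"
      by (simp add: power2_eq_square algebra_simps)
    have "n \<le> v $ ?l"
    proof (cases "n = 0")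
      case True
      \<comment> \<open>For n = 0 the reflected vector is zero and carries no information; the axis
        of the cone replaces it.\<close>
      have "axis ?l 1 \<in> SOC" by (auto simp: SOC_def axis_def L2_set_def)
      then show ?thesis using dual True by (force simp: inner_axis)
    next
      case False
      then have "0 < n" by (simp add: n_def order_less_le)
      then show ?thesis using * by (simp add: zero_le_mult_iff)
    qed
    then show "v \<in> SOC" by (simp add: SOC_def n_def)
  qed
qed

lemma SOC_add: "v \<in> SOC \<Longrightarrow> w \<in> SOC \<Longrightarrow> v + w \<in> SOC"
  by (auto simp: SOC_self_dual[of "v + w"] SOC_self_dual[of v] SOC_self_dual[of w] inner_add_left)

lemma SOC_scaleR: "0 \<le> c \<Longrightarrow> v \<in> SOC \<Longrightarrow> c *\<^sub>R v \<in> SOC"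
  by (auto simp: SOC_self_dual[of "c *\<^sub>R v"] SOC_self_dual[of v])

lemma zero_in_SOC: "0 \<in> SOC"
  by (simp add: SOC_self_dual[of 0])

lemma symmetric_Shat: "symmetric (Shat U)"
  by (simp add: Shat_def symmetric_diff symmetric_sum symmetric_outer)

text \<open>\<open>Shat\<close> is the Lorentz form pulled back along \<open>Rhat\<close>, hence
  nonnegative wherever the second-order constraint holds.\<close>

lemma inner_Shat:
  "u \<bullet> (Shat U *v u) = ((Rhat U *v u) $ last_index)\<^sup>2
     - (\<Sum>l\<in>UNIV - {last_index}. ((Rhat U *v u) $ l)\<^sup>2)"
  unfolding Shat_def bilinear_simps inner_transpose_vector
  by (simp add: inner_axis' power2_eq_square)

text \<open>The four terms have separate reasons: semidefiniteness, the squared cone inequality,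
  nonnegative entries of \<open>\<Sigma>\<close> against \<open>Phat U *v u\<close>, and
  self-duality between the rows of \<open>\<Phi>\<close> and \<open>Rhat U *v u\<close>.\<close>

lemma IA_cone_copositive:
  assumes "V \<in> IA_cone U" and u: "u \<in> cone_K U"
  shows "0 \<le> u \<bullet> (V *v u)"
proof -
  let ?P = "Phat U *v u" and ?R = "Rhat U *v u"
  obtain W \<tau> \<Sigma> \<Phi> where
    V: "V = W + \<tau> *\<^sub>R Shat U + transpose (Phat U) ** \<Sigma> ** Phat U
      + (1/2) *\<^sub>R (transpose (Phat U) ** \<Phi> ** Rhat U + transpose (Rhat U) ** transpose \<Phi> ** Phat U)"
    and W: "psd W" "0 \<le> \<tau>" and nonneg: "\<And>l m. 0 \<le> \<Sigma> $ l $ m" and rows: "\<And>l. \<Phi> $ l \<in> SOC"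
    using assms(1) unfolding IA_cone_def by blast
  have P: "0 \<le> ?P $ l" for l using u by (auto simp: cone_K_def)
  have R: "?R \<in> SOC" using u by (auto simp: cone_K_def)
  have "u \<bullet> (V *v u) = u \<bullet> (W *v u) + \<tau> * (u \<bullet> (Shat U *v u)) + ?P \<bullet> (\<Sigma> *v ?P) + ?P \<bullet> (\<Phi> *v ?R)"
    unfolding V by (simp only: bilinear_simps inner_transpose_vector)
      (simp add: inner_commute[of "\<Phi> *v _"] inner_commute[of "\<Sigma> *v _"] dot_lmul_matrix)
  moreover have "0 \<le> u \<bullet> (W *v u)" using W by (simp add: psd_def)
  moreover have "0 \<le> u \<bullet> (Shat U *v u)"
  proof -
    have "sqrt (\<Sum>l\<in>UNIV - {last_index}. (?R $ l)\<^sup>2) \<le> ?R $ last_index"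
      using R by (simp add: SOC_def L2_set_def)
    then show ?thesis unfolding inner_Shat by (auto dest: sqrt_le_D)
  qed
  moreover have "0 \<le> ?P \<bullet> (\<Sigma> *v ?P)"
  proof -
    have "0 \<le> (\<Sigma> *v ?P) $ l" for l
      unfolding matrix_vector_mult_def[of \<Sigma>] by (simp add: sum_nonneg nonneg P)
    then show ?thesis
      unfolding inner_vec_def by (simp add: sum_nonneg P)
  qed
  moreover have "0 \<le> ?P \<bullet> (\<Phi> *v ?R)"
  proof -
    have "0 \<le> (\<Phi> *v ?R) $ l" for l
      using rows R SOC_self_dual unfolding matrix_mult_dot[of \<Phi>] by fastforce
    then show ?thesis
      unfolding inner_vec_def by (simp add: sum_nonneg P)
  qed
  ultimately show ?thesis using W by simp
qed

text \<open>A Farkas-type alternative: an implied sign constraint is certified by multipliers. Such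
  certificates usually rest on closedness of the generated cone; here weak separation is enough,
  because compactness of the slice excludes the resulting normal.\<close>

lemma last_unit_representation:
  fixes U :: "('k::finite, 'p::finite, 'r::{finite,linorder}, 'i::finite) uncertainty"
  assumes "assumption_A1 U"
    and nonneg: "\<And>u. (\<forall>l. 0 \<le> (Phat U *v u) $ l) \<Longrightarrow> Rhat U *v u \<in> SOC \<Longrightarrow> 0 \<le> u $ None"
  obtains a :: "real ^ 'p" and b :: "(real, 'r) vec" where "\<And>l. 0 \<le> a $ l" "b \<in> SOC"
    "last_unit = transpose (Phat U) *v a + transpose (Rhat U) *v b"
proof -
  define D where "D = {transpose (Phat U) *v a + transpose (Rhat U) *v b | a b. (\<forall>l. 0 \<le> a $ l) \<and> b \<in> SOC}"
  have D_I: "transpose (Phat U) *v a + transpose (Rhat U) *v b \<in> D" if "\<And>l. 0 \<le> a $ l" "b \<in> SOC" for a b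
    using that unfolding D_def by blast
  have D_add: "x + y \<in> D" if "x \<in> D" "y \<in> D" for x y
  proof -
    from that obtain a b a' b' where
      xy: "x = transpose (Phat U) *v a + transpose (Rhat U) *v b"
        "y = transpose (Phat U) *v a' + transpose (Rhat U) *v b'"
      and "\<forall>l. 0 \<le> a $ l" "b \<in> SOC" "\<forall>l. 0 \<le> a' $ l" "b' \<in> SOC" unfolding D_def by blast
    then have "transpose (Phat U) *v (a + a') + transpose (Rhat U) *v (b + b') \<in> D"
      by (intro D_I SOC_add) auto
    then show ?thesis unfolding xy matrix_vector_right_distrib by (simp only: ac_simps)
  qed
  have D_scaleR: "c *\<^sub>R x \<in> D" if "x \<in> D" "0 \<le> c" for x c
  proof -
    from that obtain a b where
      x: "x = transpose (Phat U) *v a + transpose (Rhat U) *v b"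
      and "\<forall>l. 0 \<le> a $ l" "b \<in> SOC" unfolding D_def by blast
    then have "transpose (Phat U) *v (c *\<^sub>R a) + transpose (Rhat U) *v (c *\<^sub>R b) \<in> D"
      using that(2) by (intro D_I SOC_scaleR) auto
    then show ?thesis unfolding x by (simp only: matrix_vector_mult_scaleR scaleR_add_right)
  qed
  have "convex D" by (auto intro!: convexI D_add D_scaleR)
  have "0 \<in> D" using D_I[of 0 0] by (simp add: zero_in_SOC)
  have "last_unit \<in> D"
  proof (rule ccontr)
    assume "last_unit \<notin> D"
    then obtain z t where "z \<noteq> 0" and le: "z \<bullet> last_unit \<le> t" and ge: "\<And>x. x \<in> D \<Longrightarrow> t \<le> z \<bullet> x"
      using separating_hyperplane_sets[of "{last_unit}" D] \<open>convex D\<close> \<open>0 \<in> D\<close> by auto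
    have "t \<le> 0" using ge[OF \<open>0 \<in> D\<close>] by simp
    \<comment> \<open>A functional bounded below on a cone is nonnegative there: scaling x by (t -
      1) / (z \<bullet> x) would reach the value t - 1. As t \<le> 0, this factor is
      nonnegative.\<close>
    have D_nonneg: "0 \<le> z \<bullet> x" if "x \<in> D" for x
    proof (rule ccontr)
      assume neg: "\<not> 0 \<le> z \<bullet> x"
      then have "t \<le> (t - 1) / (z \<bullet> x) * (z \<bullet> x)"
        using ge[OF D_scaleR[OF that, of "(t - 1) / (z \<bullet> x)"]] \<open>t \<le> 0\<close>
        by (simp add: divide_nonpos_neg)
      then show False using neg by simp
    qed
    \<comment> \<open>The two kinds of generators of \<open>D\<close> are tested separately, each
      with the other coefficient vector set to 0.\<close>
    have P: "\<forall>l. 0 \<le> (Phat U *v z) $ l"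
    proof
      fix l
      have "0 \<le> z \<bullet> (transpose (Phat U) *v axis l 1 + transpose (Rhat U) *v 0)"
        by (intro D_nonneg D_I) (auto simp: axis_def zero_in_SOC)
      then show "0 \<le> (Phat U *v z) $ l"
        by (simp only: inner_add_right inner_transpose_matrix) (simp add: inner_axis')
    qed
    have R: "Rhat U *v z \<in> SOC"
      unfolding SOC_self_dual
    proof
      fix b :: "(real, 'r) vec" assume "b \<in> SOC"
      then have "0 \<le> z \<bullet> (transpose (Phat U) *v 0 + transpose (Rhat U) *v b)"
        by (intro D_nonneg D_I) auto
      then show "0 \<le> (Rhat U *v z) \<bullet> b"
        by (simp only: inner_add_right inner_transpose_matrix) (simp add: inner_commute)
    qed
    \<comment> \<open>Separation yields only a nonpositive last entry; the implied sign constraint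
      gives the reverse inequality, so adding multiples of z keeps the last coordinate at 1.\<close>
    have z_None: "z $ None = 0"
      using nonneg[OF P R] le \<open>t \<le> 0\<close> by (simp add: inner_axis)
    obtain v where v: "v \<in> uset0 U" and "bounded (uset0 U)"
      using assms(1) by (auto simp: assumption_A1_def compact_imp_bounded)
    then obtain B where B: "\<And>u. u \<in> uset0 U \<Longrightarrow> norm u \<le> B"
      by (auto simp: bounded_iff)
    have "v + s *\<^sub>R z \<in> uset0 U" if "0 \<le> s" for s
      using v that P R z_None
      by (auto simp: uset0_def cone_K_def matrix_vector_right_distrib matrix_vector_mult_scaleR
          intro!: SOC_add SOC_scaleR)
    then have bound: "norm (v + s *\<^sub>R z) \<le> B" if "0 \<le> s" for s
      using that B by blast
    \<comment> \<open>Chosen so that s z has norm B + |v| + 1, which forces v + s z to have norm at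
      least B + 1.\<close>
    define s where "s = (B + norm v + 1) / norm z"
    have "0 \<le> B" using B[OF v] by (rule order_trans[OF norm_ge_zero])
    then have "0 \<le> s" by (simp add: s_def)
    have "B + norm v + 1 = norm (s *\<^sub>R z)"
      using \<open>z \<noteq> 0\<close> \<open>0 \<le> B\<close> by (simp add: s_def)
    also have "\<dots> \<le> norm (v + s *\<^sub>R z) + norm v"
      using norm_triangle_ineq4[of "v + s *\<^sub>R z" v] by simp
    finally show False using bound[OF \<open>0 \<le> s\<close>] by linarith
  qed
  then show ?thesis using that unfolding D_def by blast
qed

lemma transpose_add_distrib: "transpose (M + N) = transpose M + transpose N"
  and transpose_diff_distrib: "transpose (M1 - N1) = transpose M1 - transpose N1"
  by (simp_all add: transpose_def vec_eq_iff)

lemma outer_add_right: "outer v (w + w') = outer v w + outer v w'"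
  by (simp add: outer_def vec_eq_iff algebra_simps)

lemma matrix_add_rdistrib: "(M + N) ** L = M ** L + N ** L"
  for L :: "real ^ 'm ^ 'n"
  by (simp add: matrix_matrix_mult_def vec_eq_iff sum.distrib algebra_simps)

text \<open>Factors the outer product so that a coefficient matrix stands in the middle, as in the
  terms of \<open>IA_cone\<close>.\<close>

lemma outer_transpose_vector:
  "outer (transpose M *v v) (transpose N *v w) = transpose M ** outer v w ** N"
  by (simp add: matrix_eq outer_mult_vector inner_transpose_vector matrix_vector_mult_scaleR
      del: transpose_matrix_vector flip: matrix_vector_mul_assoc)

text \<open>Writing \<open>e = P\<^sup>T a + R\<^sup>T b\<close> gives \<open>P\<^sup>T \<theta> e\<^sup>T = P\<^sup>T (\<theta> a\<^sup>T) P + P\<^sup>T (\<theta> b\<^sup>T) R\<close>,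
  both of whose summands, once symmetrised, lie in the inner approximation.\<close>

lemma AS_cone_subset_IA_cone:
  assumes "assumption_A1 U"
    and "\<And>u. (\<forall>l. 0 \<le> (Phat U *v u) $ l) \<Longrightarrow> Rhat U *v u \<in> SOC \<Longrightarrow> 0 \<le> u $ None"
  shows "AS_cone U \<subseteq> IA_cone U"
proof
  fix V assume "V \<in> AS_cone U"
  then obtain W \<tau> \<theta> where V: "V = W + \<tau> *\<^sub>R Shat U
       + (1/2) *\<^sub>R (outer (transpose (Phat U) *v \<theta>) last_unit
           + outer last_unit (transpose (Phat U) *v \<theta>))"
    and W: "psd W" "0 \<le> \<tau>" and \<theta>: "\<And>l. 0 \<le> \<theta> $ l"
    unfolding AS_cone_def by blast
  obtain a b where a: "\<And>l. 0 \<le> a $ l" and b: "b \<in> SOC"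
    and e: "last_unit = transpose (Phat U) *v a + transpose (Rhat U) *v b"
    using last_unit_representation[OF assms] by blast
  \<comment> \<open>The matrix \<theta> a^T has nonnegative entries but need not be symmetric, as
    \<open>IA_cone\<close> demands. Symmetrising loses nothing because \<open>O\<close> and
    \<open>O'\<close> contribute both transposes.\<close>
  define \<Sigma> where "\<Sigma> = (1/2) *\<^sub>R (outer \<theta> a + transpose (outer \<theta> a))"
  have O: "outer (transpose (Phat U) *v \<theta>) last_unit
    = transpose (Phat U) ** outer \<theta> a ** Phat U + transpose (Phat U) ** outer \<theta> b ** Rhat U"
    unfolding e outer_add_right outer_transpose_vector ..
  have O': "outer last_unit (transpose (Phat U) *v \<theta>)
    = transpose (Phat U) ** transpose (outer \<theta> a) ** Phat U
      + transpose (Rhat U) ** transpose (outer \<theta> b) ** Phat U"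
    using arg_cong[OF O, of transpose]
    by (simp add: transpose_outer transpose_add_distrib matrix_transpose_mul matrix_mul_assoc
        del: transpose_matrix_vector)
  have \<Sigma>: "transpose (Phat U) ** \<Sigma> ** Phat U = (1/2) *\<^sub>R (transpose (Phat U) ** outer \<theta> a ** Phat U
      + transpose (Phat U) ** transpose (outer \<theta> a) ** Phat U)"
    by (simp add: \<Sigma>_def matrix_add_ldistrib matrix_add_rdistrib matrix_scalar_ac
        scaleR_add_right flip: scalar_matrix_assoc)
  have "V = W + \<tau> *\<^sub>R Shat U + transpose (Phat U) ** \<Sigma> ** Phat U
       + (1/2) *\<^sub>R (transpose (Phat U) ** outer \<theta> b ** Rhat U
           + transpose (Rhat U) ** transpose (outer \<theta> b) ** Phat U)"
    unfolding V O O' \<Sigma> by (simp add: algebra_simps)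
  moreover have "symmetric \<Sigma>"
    unfolding \<Sigma>_def by (intro symmetric_scaleR symmetric_add_transpose)
  moreover have "0 \<le> \<Sigma> $ l $ m" for l m
    using \<theta> a by (simp add: \<Sigma>_def outer_def transpose_def)
  moreover have "outer \<theta> b $ l \<in> SOC" for l
    using SOC_scaleR[OF \<theta>[of l] b] by (simp add: outer_def scaleR_vec_def)
  ultimately show "V \<in> IA_cone U"
    unfolding IA_cone_def using W by blast
qed

section \<open>The constraint matrices evaluated on the slice\<close>

lemma inner_Theta: "u \<bullet> (Theta T j *v x) = (Afun T u *v x) $ j"
  unfolding Theta_def Afun_def inner_vec_def matrix_vector_mult_def
  by (simp add: sum_distrib_left sum_distrib_right mult_ac) (rule sum.swap)

lemma inner_Lambda: "u \<bullet> (Lambda T j *v y) = (Bfun T u *v y) $ j"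
  unfolding Lambda_def Defs.Bfun_def inner_vec_def matrix_vector_mult_def
  by (simp add: sum_distrib_left sum_distrib_right mult_ac) (rule sum.swap)

lemma inner_Omega:
  assumes "u $ None = 1"
  shows "u \<bullet> (Omega T j x Y *v u) = (Afun T u *v x + Bfun T u *v (Y *v u) - hfun T u) $ j"
proof -
  have "(Hhat T *v u) $ j = Hhat T $ j \<bullet> u" by (simp add: matrix_mult_dot)
  then show ?thesis
    unfolding Omega_def hfun_def
    by (simp only: bilinear_simps inner_transpose_vector inner_Theta inner_Lambda inner_axis inner_axis' assms
        inner_commute[of "Theta T j *v x"] inner_commute[of "Hhat T $ j"]) (simp add: inner_commute)
qed

lemma inner_Gamma:
  assumes "u $ None = 1"
  shows "u \<bullet> (Gamma T B j x Q *v u)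
    = (Afun T u *v x + B *v (\<chi> n. u \<bullet> (Q n *v u)) - hfun T u) $ j"
proof -
  have "(Hhat T *v u) $ j = Hhat T $ j \<bullet> u" by (simp add: matrix_mult_dot)
  then show ?thesis
    unfolding Gamma_def hfun_def
    by (simp only: bilinear_simps inner_Theta inner_axis inner_axis' assms
        inner_commute[of "Theta T j *v x"])
      (simp add: inner_commute matrix_vector_mult_def[of B])
qed

section \<open>Polynomials of degree at most two\<close>

text \<open>The argument is a vector of R^(K+1) whose last entry is ignored, so that on the slice
  polynomials and quadratic forms are evaluated at the same point.\<close>

definition peval :: "real ^ 'k::finite option \<Rightarrow> 'k polynomial \<Rightarrow> real"
  where "peval u p = (\<Sum>m\<in>Poly_Mapping.keys p.
    Poly_Mapping.lookup p m * (\<Prod>i\<in>UNIV. (u $ Some i) ^ Poly_Mapping.lookup m i))"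

text \<open>Supports of summands and sum differ; a common finite index set makes additivity a
  termwise identity.\<close>

lemma peval_superset:
  assumes "finite A" "Poly_Mapping.keys p \<subseteq> A"
  shows "peval u p = (\<Sum>m\<in>A.
    Poly_Mapping.lookup p m * (\<Prod>i\<in>UNIV. (u $ Some i) ^ Poly_Mapping.lookup m i))"
  unfolding peval_def using assms
  by (intro sum.mono_neutral_left) (auto simp: in_keys_iff)

lemma peval_add: "peval u (p + q) = peval u p + peval u q"
proof -
  let ?A = "Poly_Mapping.keys p \<union> Poly_Mapping.keys q"
  show ?thesis
    using peval_superset[of ?A p u] peval_superset[of ?A q u] peval_superset[of ?A "p + q" u]
    by (simp add: Poly_Mapping.keys_add lookup_add distrib_right sum.distrib)
qed

lemma peval_zero: "peval u 0 = 0"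
  by (simp add: peval_def)

lemma peval_sum: "peval u (sum f A) = (\<Sum>a\<in>A. peval u (f a))"
  by (induction A rule: infinite_finite_induct) (simp_all add: peval_zero peval_add)

lemma peval_sum_list: "peval u (\<Sum>a\<leftarrow>as. f a) = (\<Sum>a\<leftarrow>as. peval u (f a))"
  by (induction as) (simp_all add: peval_zero peval_add)

lemma peval_diff: "peval u (p - q) = peval u p - peval u q"
  using peval_add[of u "p - q" q] by simp

lemma peval_single:
  "peval u (Poly_Mapping.single m c) = c * (\<Prod>i\<in>UNIV. (u $ Some i) ^ Poly_Mapping.lookup m i)"
  by (simp add: peval_def)

lemma polynomial_eq_sum_single:
  fixes p :: "'k polynomial"
  shows "p = (\<Sum>m\<in>Poly_Mapping.keys p. Poly_Mapping.single m (Poly_Mapping.lookup p m))"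
proof (rule poly_mapping_eqI)
  fix m
  show "Poly_Mapping.lookup p m
    = Poly_Mapping.lookup (\<Sum>m\<in>Poly_Mapping.keys p. Poly_Mapping.single m (Poly_Mapping.lookup p m)) m"
    by (simp add: lookup_sum lookup_single when_def sum.delta in_keys_iff)
qed

lemma peval_mult: "peval u (p * q) = peval u p * peval u q"
proof -
  have single: "peval u (Poly_Mapping.single m a * Poly_Mapping.single n b)
      = peval u (Poly_Mapping.single m a) * peval u (Poly_Mapping.single n b)" for m n a b
    by (simp add: mult_single peval_single lookup_add power_add prod.distrib)
  show ?thesis
    apply (subst (1 2) polynomial_eq_sum_single[of p])
    apply (subst (1 2) polynomial_eq_sum_single[of q])
    apply (simp only: sum_product peval_sum single)
    done
qed

lemma peval_Const: "peval u (Const c) = c"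
  by (simp add: Const_def peval_single)

lemma peval_coord: "u $ None = 1 \<Longrightarrow> peval u (coord k) = u $ k"
proof (cases k)
  case None
  then show "u $ None = 1 \<Longrightarrow> ?thesis"
    using peval_Const[of u 1] by (simp add: coord_def Const_def)
next
  case (Some i)
  have "(\<Prod>j\<in>UNIV. (u $ Some j) ^ (1 when i = j)) = u $ Some i"
    by (subst prod.remove[of _ i]) (auto simp: when_def intro!: prod.neutral)
  then show ?thesis
    by (simp add: Some coord_def Var_def peval_single lookup_single)
qed

lemma peval_lin_poly: "u $ None = 1 \<Longrightarrow> peval u (lin_poly a) = a \<bullet> u"
  by (simp add: lin_poly_def peval_sum peval_mult peval_Const peval_coord inner_vec_def)

lemma peval_quad_poly: "u $ None = 1 \<Longrightarrow> peval u (quad_poly M) = u \<bullet> (M *v u)"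
  by (simp add: quad_poly_def peval_sum peval_mult peval_Const peval_coord inner_vec_def
      matrix_vector_mult_def sum_distrib_left mult_ac)

lemmas peval_simps = peval_add peval_diff peval_sum peval_mult peval_Const peval_lin_poly peval_quad_poly

section \<open>Degree bounds\<close>

lemma degree_le_mono: "degree_le d p \<Longrightarrow> d \<le> e \<Longrightarrow> degree_le e p"
  by (force simp: degree_le_def)

lemma degree_le_add: "degree_le d p \<Longrightarrow> degree_le d q \<Longrightarrow> degree_le d (p + q)"
  using Poly_Mapping.keys_add[of p q] by (auto simp: degree_le_def)

lemma degree_le_diff: "degree_le d p \<Longrightarrow> degree_le d q \<Longrightarrow> degree_le d (p - q)"
  using keys_diff[of p q] by (auto simp: degree_le_def)

lemma degree_le_sum: "(\<And>a. a \<in> A \<Longrightarrow> degree_le d (f a)) \<Longrightarrow> degree_le d (sum f A)"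
  by (induction A rule: infinite_finite_induct) (auto simp: degree_le_add degree_le_def[of d 0])

lemma degree_le_mult: "degree_le d p \<Longrightarrow> degree_le e q \<Longrightarrow> degree_le (d + e) (p * q)"
  using keys_mult[of p q] by (fastforce simp: degree_le_def lookup_add sum.distrib intro: add_mono)

lemma degree_le_single:
  "(\<Sum>i\<in>UNIV. Poly_Mapping.lookup m i) \<le> d \<Longrightarrow> degree_le d (Poly_Mapping.single m c)"
  by (simp add: degree_le_def)

lemma degree_le_Const: "degree_le d (Const c)"
  by (simp add: Const_def degree_le_single)

lemma degree_le_coord: "degree_le 1 (coord k)"
proof (cases k)
  case None
  then show ?thesis using degree_le_Const[of 1 1] by (simp add: coord_def Const_def)
next
  case (Some i)
  have "(\<Sum>j\<in>UNIV. (1 :: nat) when i = j) = 1"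
    by (simp add: when_def)
  then show ?thesis unfolding Some coord_def Var_def
    by (simp add: degree_le_single lookup_single)
qed

lemma degree_le_lin_poly: "degree_le 1 (lin_poly a)"
  unfolding lin_poly_def
  using degree_le_mult[OF degree_le_Const[of 0] degree_le_coord] by (intro degree_le_sum) simp

lemma degree_le_quad_poly: "degree_le 2 (quad_poly M)"
proof -
  have "degree_le (0 + 1 + 1) (Const (M $ k $ l) * coord k * coord l)" for k l
    by (intro degree_le_mult degree_le_Const degree_le_coord)
  then show ?thesis unfolding quad_poly_def by (intro degree_le_sum) (simp add: numeral_2_eq_2)
qed

lemma degree_le_Const_mult: "degree_le d p \<Longrightarrow> degree_le d (Const c * p)"
  using degree_le_mult[OF degree_le_Const[of 0]] by simp

lemma degree_le_lin_poly_mult: "degree_le 1 q \<Longrightarrow> degree_le 2 (lin_poly a * q)"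
  using degree_le_mult[OF degree_le_lin_poly, of 1 q a] by (simp add: numeral_2_eq_2)

lemma degree_le_2_lin_poly: "degree_le 2 (lin_poly a)"
  by (rule degree_le_mono[OF degree_le_lin_poly]) simp

lemmas degree_le_intros = degree_le_add degree_le_diff degree_le_sum degree_le_Const
  degree_le_Const_mult degree_le_2_lin_poly degree_le_quad_poly degree_le_lin_poly_mult

section \<open>Linear and quadratic polynomials and their coefficients\<close>

lemma Const_zero: "Const 0 = 0"
  and Const_add: "Const (a + b) = Const a + Const b"
  and Const_mult: "Const (a * b) = Const a * Const b"
  by (simp_all add: Const_def single_add mult_single)

lemma lin_poly_add: "lin_poly (a + b) = lin_poly a + lin_poly b"
  by (simp add: lin_poly_def Const_add distrib_right sum.distrib)

lemma lin_poly_zero: "lin_poly 0 = 0"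
  by (simp add: lin_poly_def Const_zero)

lemma lin_poly_sum: "lin_poly (sum f A) = (\<Sum>a\<in>A. lin_poly (f a))"
  by (induction A rule: infinite_finite_induct) (simp_all add: lin_poly_zero lin_poly_add)

lemma quad_poly_add: "quad_poly (M + N) = quad_poly M + quad_poly N"
  by (simp add: quad_poly_def Const_add distrib_right sum.distrib)

lemma quad_poly_zero: "quad_poly 0 = 0"
  by (simp add: quad_poly_def Const_zero)

lemma quad_poly_sum: "quad_poly (sum f A) = (\<Sum>a\<in>A. quad_poly (f a))"
  by (induction A rule: infinite_finite_induct) (simp_all add: quad_poly_zero quad_poly_add)

lemma quad_poly_transpose: "quad_poly (transpose M) = quad_poly M"
  unfolding quad_poly_def by (subst sum.swap) (simp add: transpose_def mult_ac)

lemma quad_poly_sym_part: "quad_poly (sym_part M) = quad_poly M"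
proof -
  have half: "quad_poly ((1/2) *\<^sub>R N) = Const (1/2) * quad_poly N" for N
    by (simp only: quad_poly_def sum_distrib_left vector_scaleR_component real_scaleR_def
        Const_mult mult.assoc)
  have "quad_poly (sym_part M) = Const (1/2) * quad_poly M + Const (1/2) * quad_poly M"
    by (simp add: sym_part_def half quad_poly_add quad_poly_transpose distrib_left)
  also have "\<dots> = Const (1/2 + 1/2) * quad_poly M"
    by (simp only: Const_add distrib_right)
  finally show ?thesis by (simp add: Const_def)
qed

lemma lin_poly_axis: "lin_poly (axis k c) = Const c * coord k"
  unfolding lin_poly_def
  by (subst sum.remove[of _ k]) (auto simp: axis_def Const_zero intro!: sum.neutral)

lemma lin_poly_mult: "lin_poly a * lin_poly b = quad_poly (outer a b)"
  by (simp add: lin_poly_def quad_poly_def outer_def sum_product Const_mult mult_ac)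

lemma single_eq_Const_mult: "Poly_Mapping.single m c = Const c * Poly_Mapping.single m 1"
  by (simp add: Const_def mult_single)

text \<open>As \<open>coord None\<close> is 1, a monomial of lower degree can be padded with the
  last coordinate, so constants and lower-degree monomials need no cases of their own later.\<close>

lemma monomial_split:
  fixes m :: "'k::finite \<Rightarrow>\<^sub>0 nat"
  assumes "(\<Sum>i\<in>UNIV. Poly_Mapping.lookup m i) \<le> Suc n"
  obtains k m' where "Poly_Mapping.single m (1::real) = coord k * Poly_Mapping.single m' 1"
    "(\<Sum>i\<in>UNIV. Poly_Mapping.lookup m' i) \<le> n"
proof (cases "m = 0")
  case True
  then show ?thesis using that[of None 0] by (simp add: coord_def)
next
  case False
  then obtain i where i: "0 < Poly_Mapping.lookup m i"
    by (metis gr0I lookup_zero poly_mapping_eqI)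
  define m' where "m' = m - Poly_Mapping.single i 1"
  have m: "m = Poly_Mapping.single i 1 + m'"
    using i by (intro poly_mapping_eqI)
      (auto simp: m'_def lookup_add lookup_minus lookup_single when_def)
  have "(\<Sum>j\<in>UNIV. Poly_Mapping.lookup m j) = Suc (\<Sum>j\<in>UNIV. Poly_Mapping.lookup m' j)"
    by (subst m) (simp add: lookup_add lookup_single when_def sum.distrib)
  then have "(\<Sum>j\<in>UNIV. Poly_Mapping.lookup m' j) \<le> n" using assms by simp
  moreover have "Poly_Mapping.single m (1::real) = coord (Some i) * Poly_Mapping.single m' 1"
    by (subst m) (simp add: coord_def Var_def mult_single)
  ultimately show ?thesis by (intro that)
qed

lemma degree_le_1_imp_lin_poly:
  assumes "degree_le 1 p"
  obtains a where "p = lin_poly a"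
proof -
  have "\<exists>a. Poly_Mapping.single m (Poly_Mapping.lookup p m) = lin_poly a"
    if "m \<in> Poly_Mapping.keys p" for m
  proof -
    let ?c = "Poly_Mapping.lookup p m"
    have "(\<Sum>i\<in>UNIV. Poly_Mapping.lookup m i) \<le> 1"
      using assms that by (auto simp: degree_le_def)
    then obtain k m' where k: "Poly_Mapping.single m (1::real) = coord k * Poly_Mapping.single m' 1"
      and "(\<Sum>i\<in>UNIV. Poly_Mapping.lookup m' i) \<le> 0"
      by (metis monomial_split One_nat_def)
    then have "m' = 0" by (intro poly_mapping_eqI) simp
    then have "Poly_Mapping.single m ?c = Const ?c * coord k"
      using k by (subst single_eq_Const_mult) simp
    then show ?thesis by (metis lin_poly_axis)
  qed
  then obtain f where "\<And>m. m \<in> Poly_Mapping.keys p \<Longrightarrow>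
      Poly_Mapping.single m (Poly_Mapping.lookup p m) = lin_poly (f m)" by metis
  then have "p = lin_poly (\<Sum>m\<in>Poly_Mapping.keys p. f m)"
    by (subst polynomial_eq_sum_single) (simp add: lin_poly_sum)
  then show ?thesis by (rule that)
qed

text \<open>Two splittings turn each monomial into a product of two coordinates, that is, a single
  matrix entry; symmetrising the total leaves the polynomial unchanged.\<close>

lemma degree_le_2_imp_quad_poly:
  assumes "degree_le 2 p"
  obtains M where "symmetric M" "p = quad_poly M"
proof -
  have "\<exists>M. Poly_Mapping.single m (Poly_Mapping.lookup p m) = quad_poly M"
    if "m \<in> Poly_Mapping.keys p" for m
  proof -
    let ?c = "Poly_Mapping.lookup p m"
    have "(\<Sum>i\<in>UNIV. Poly_Mapping.lookup m i) \<le> Suc 1"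
      using assms that by (auto simp: degree_le_def)
    then obtain k m' where k: "Poly_Mapping.single m (1::real) = coord k * Poly_Mapping.single m' 1"
      and "(\<Sum>i\<in>UNIV. Poly_Mapping.lookup m' i) \<le> Suc 0"
      by (metis monomial_split One_nat_def)
    then obtain l m'' where l: "Poly_Mapping.single m' (1::real) = coord l * Poly_Mapping.single m'' 1"
      and "(\<Sum>i\<in>UNIV. Poly_Mapping.lookup m'' i) \<le> 0"
      by (metis monomial_split)
    then have "m'' = 0" by (intro poly_mapping_eqI) simp
    then have "Poly_Mapping.single m ?c = Const ?c * coord k * coord l"
      using k l by (subst single_eq_Const_mult) (simp add: mult.assoc)
    also have "\<dots> = quad_poly (outer (axis k ?c) (axis l 1))"
      by (simp add: lin_poly_axis mult.assoc Const_def flip: lin_poly_mult)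
    finally show ?thesis by blast
  qed
  then obtain f where "\<And>m. m \<in> Poly_Mapping.keys p \<Longrightarrow>
      Poly_Mapping.single m (Poly_Mapping.lookup p m) = quad_poly (f m)" by metis
  then have "p = quad_poly (\<Sum>m\<in>Poly_Mapping.keys p. f m)"
    by (subst polynomial_eq_sum_single) (simp add: quad_poly_sum)
  then have "p = quad_poly (sym_part (\<Sum>m\<in>Poly_Mapping.keys p. f m))"
    by (simp add: quad_poly_sym_part)
  then show ?thesis by (rule that[OF symmetric_sym_part])
qed

lemma degree_le_2_eqI:
  assumes "degree_le 2 p" "degree_le 2 q"
    and eq: "\<And>u. u $ None = 1 \<Longrightarrow> peval u p = peval u q"
  shows "p = q"
proof -
  obtain M N where "symmetric M" "symmetric N" and pq: "p = quad_poly M" "q = quad_poly N"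
    using assms(1,2) by (metis degree_le_2_imp_quad_poly)
  then have "M = N"
    using eq by (intro symmetric_eqI) (simp_all add: peval_quad_poly)
  then show ?thesis by (simp add: pq)
qed

lemma peval_sum_of_squares_nonneg: "sum_of_squares p \<Longrightarrow> 0 \<le> peval u p"
  by (auto simp: sum_of_squares_def peval_sum_list power2_eq_square peval_mult intro!: sum_list_nonneg)

text \<open>A quadratic sum of squares is nonnegative everywhere, so its symmetric Gram matrix is
  automatically positive semidefinite: the degrees of the summands need not be examined.\<close>

lemma sum_of_squares_iff_psd:
  fixes p :: "'a::finite polynomial"
  shows "sum_of_squares p \<and> degree_le 2 p \<longleftrightarrow> (\<exists>W. psd W \<and> p = quad_poly W)"
proof
  assume p: "sum_of_squares p \<and> degree_le 2 p"
  then obtain W where W: "symmetric W" "p = quad_poly W"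
    using degree_le_2_imp_quad_poly by blast
  have "0 \<le> u \<bullet> (W *v u)" for u
  proof (rule nonneg_slice_imp_nonneg)
    fix v :: "real ^ 'a option" assume "v $ None = 1"
    then show "0 \<le> v \<bullet> (W *v v)"
      using peval_sum_of_squares_nonneg[of p v] p W(2) peval_quad_poly[of v W] by simp
  qed
  then show "\<exists>W. psd W \<and> p = quad_poly W" using W by (auto simp: psd_def)
next
  assume "\<exists>W. psd W \<and> p = quad_poly W"
  then obtain W where "psd W" and p: "p = quad_poly W" by blast
  then obtain ws where "W = (\<Sum>w\<leftarrow>ws. outer w w)" using psd_eq_sum_outer by blast
  moreover have "quad_poly (\<Sum>w\<leftarrow>ws. outer w w) = (\<Sum>q\<leftarrow>map lin_poly ws. q ^ 2)"
    by (induction ws) (simp_all add: quad_poly_zero quad_poly_add power2_eq_square lin_poly_mult)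
  ultimately have "p = (\<Sum>q\<leftarrow>map lin_poly ws. q ^ 2)" by (simp only: p)
  then have "sum_of_squares p"
    unfolding sum_of_squares_def by (intro exI[of _ "map lin_poly ws"])
  then show "sum_of_squares p \<and> degree_le 2 p"
    by (simp add: p degree_le_quad_poly)
qed

text \<open>Both sides are quadratics, so the polynomial identity defining \<^const>\<open>SOS2\<close>
  and the matrix identity defining \<^const>\<open>AS_cone\<close> can be compared by values on the slice
  \<open>u\<^sub>K\<^sub>+\<^sub>1 = 1\<close>, where \<open>P\<^sup>T \<theta> e\<^sup>T\<close> evaluates to the linear polynomial \<open>\<theta>\<^sup>T P u\<close>.\<close>

lemma SOS2_iff_AS_cone:
  fixes U :: "('k::finite, 'p::finite, 'r::{finite,linorder}, 'i::finite) uncertainty"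
  assumes C: "\<And>i. symmetric (Chat U i)"
    and M: "symmetric M" and "degree_le 2 p"
    and p: "\<And>u. u $ None = 1 \<Longrightarrow> peval u p = u \<bullet> (M *v u)"
  shows "SOS2 U p \<longleftrightarrow> (\<exists>\<gamma>. M - (\<Sum>i\<in>UNIV. \<gamma> i *\<^sub>R Chat U i) \<in> AS_cone U)"
proof -
  define V where "V W \<tau> \<theta> = W + \<tau> *\<^sub>R Shat U
       + (1/2) *\<^sub>R (outer (transpose (Phat U) *v \<theta>) last_unit
           + outer last_unit (transpose (Phat U) *v \<theta>))" for W \<tau> \<theta>
  define P where "P W \<tau> \<theta> \<gamma> = quad_poly W + (\<Sum>l\<in>UNIV. Const (\<theta> l) * lin_poly (Phat U $ l))
           + Const \<tau> * quad_poly (Shat U)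
           + (\<Sum>i\<in>UNIV. Const (\<gamma> i) * quad_poly (Chat U i))" for W \<tau> \<theta> \<gamma>
  have sym: "symmetric (V W \<tau> \<theta>)" if "psd W" for W \<tau> \<theta>
    \<comment> \<open>The last outer product becomes the transpose of its partner, so that their sum
      is visibly symmetric.\<close>
    unfolding V_def transpose_outer[symmetric, of last_unit "transpose _ *v _"]
    by (intro symmetric_add symmetric_scaleR symmetric_add_transpose symmetric_Shat)
      (use that in \<open>simp add: psd_def\<close>)
  have eval: "peval u (P W \<tau> (($) \<theta>) \<gamma>)
      = u \<bullet> (V W \<tau> \<theta> *v u) + u \<bullet> ((\<Sum>i\<in>UNIV. \<gamma> i *\<^sub>R Chat U i) *v u)"
    if "u $ None = 1" for u W \<tau> \<theta> \<gamma>
    unfolding V_def P_def bilinear_simps inner_transpose_vector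
    by (simp add: peval_simps that inner_axis inner_axis' matrix_mult_dot inner_vec_def[of \<theta>])
  have iff: "p = P W \<tau> (($) \<theta>) \<gamma> \<longleftrightarrow> M - (\<Sum>i\<in>UNIV. \<gamma> i *\<^sub>R Chat U i) = V W \<tau> \<theta>"
    if "psd W" for W \<tau> \<theta> \<gamma>
  proof
    assume eq: "p = P W \<tau> (($) \<theta>) \<gamma>"
    show "M - (\<Sum>i\<in>UNIV. \<gamma> i *\<^sub>R Chat U i) = V W \<tau> \<theta>"
    proof (rule symmetric_eqI)
      fix u :: "real ^ 'k option" assume "u $ None = 1"
      then show "u \<bullet> ((M - (\<Sum>i\<in>UNIV. \<gamma> i *\<^sub>R Chat U i)) *v u) = u \<bullet> (V W \<tau> \<theta> *v u)"
        using eval[of u W \<tau> \<theta> \<gamma>] p[of u] by (simp only: eq inner_diff_matrix) simp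
    qed (simp_all add: symmetric_diff symmetric_sum symmetric_scaleR M C sym that)
  next
    assume *: "M - (\<Sum>i\<in>UNIV. \<gamma> i *\<^sub>R Chat U i) = V W \<tau> \<theta>"
    have "degree_le 2 (P W \<tau> (($) \<theta>) \<gamma>)"
      unfolding P_def by (intro degree_le_intros)
    with \<open>degree_le 2 p\<close> show "p = P W \<tau> (($) \<theta>) \<gamma>"
    proof (rule degree_le_2_eqI)
      fix u :: "real ^ 'k option" assume "u $ None = 1"
      then show "peval u p = peval u (P W \<tau> (($) \<theta>) \<gamma>)"
        by (simp add: eval p inner_diff_matrix flip: *)
    qed
  qed
  have "SOS2 U p \<longleftrightarrow> (\<exists>W \<tau> \<theta> \<gamma>. psd W \<and> 0 \<le> \<tau> \<and> (\<forall>l. 0 \<le> \<theta> $ l) \<and> p = P W \<tau> (($) \<theta>) \<gamma>)"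
  proof
    assume "SOS2 U p"
    then obtain \<sigma> \<theta> \<tau> \<gamma> where \<sigma>: "sum_of_squares \<sigma> \<and> degree_le 2 \<sigma>"
      and "\<forall>l. 0 \<le> \<theta> l" "0 \<le> \<tau>"
      and "p = \<sigma> + (\<Sum>l\<in>UNIV. Const (\<theta> l) * lin_poly (Phat U $ l))
           + Const \<tau> * quad_poly (Shat U) + (\<Sum>i\<in>UNIV. Const (\<gamma> i) * quad_poly (Chat U i))"
      unfolding SOS2_def by auto
    moreover obtain W where "psd W" "\<sigma> = quad_poly W"
      using \<sigma> unfolding sum_of_squares_iff_psd by auto
    ultimately show "\<exists>W \<tau> \<theta> \<gamma>. psd W \<and> 0 \<le> \<tau> \<and> (\<forall>l. 0 \<le> \<theta> $ l) \<and> p = P W \<tau> (($) \<theta>) \<gamma>"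
      by (intro exI[of _ W] exI[of _ \<tau>] exI[of _ "vec_lambda \<theta>"] exI[of _ \<gamma>]) (simp add: P_def)
  next
    assume "\<exists>W \<tau> \<theta> \<gamma>. psd W \<and> 0 \<le> \<tau> \<and> (\<forall>l. 0 \<le> \<theta> $ l) \<and> p = P W \<tau> (($) \<theta>) \<gamma>"
    then obtain W \<tau> \<theta> \<gamma> where "psd W" "0 \<le> \<tau>" "\<forall>l. 0 \<le> \<theta> $ l" "p = P W \<tau> (($) \<theta>) \<gamma>"
      by auto
    moreover from \<open>psd W\<close> have "sum_of_squares (quad_poly W) \<and> degree_le 2 (quad_poly W)"
      unfolding sum_of_squares_iff_psd by auto
    ultimately show "SOS2 U p"
      unfolding SOS2_def
      by (intro exI[of _ "quad_poly W"] exI[of _ "($) \<theta>"] exI[of _ \<tau>] exI[of _ \<gamma>]) (simp add: P_def)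
  qed
  also have "\<dots> \<longleftrightarrow> (\<exists>\<gamma>. M - (\<Sum>i\<in>UNIV. \<gamma> i *\<^sub>R Chat U i) \<in> AS_cone U)"
    unfolding AS_cone_def V_def[symmetric] using iff by blast
  finally show ?thesis .
qed

section \<open>Comparison of the optimal values\<close>

text \<open>The epigraph value \<open>lam\<close> bounds the worst-case cost. This includes an empty
  \<open>uset U\<close>, where the supremum is -\<infinity>.\<close>

lemma policy_value_le:
  assumes "x \<in> feas T" "y \<in> \<Y>"
    and "\<And>u j. u \<in> uset U \<Longrightarrow> 0 \<le> (Afun T u *v x + Bfun T u *v y u - hfun T u) $ j"
    and "\<And>u. u \<in> uset U \<Longrightarrow> dfun T u \<bullet> y u \<le> lam"
  shows "policy_value U T \<Y> \<le> ereal (cost T \<bullet> x + lam)"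
proof -
  have "policy_value U T \<Y> \<le> ereal (cost T \<bullet> x) + (SUP u\<in>uset U. ereal (dfun T u \<bullet> y u))"
    unfolding policy_value_def using assms(1-3) by (intro Inf_lower) force
  also have "\<dots> \<le> ereal (cost T \<bullet> x) + ereal lam"
    by (intro add_left_mono SUP_least) (simp add: assms(4))
  finally show ?thesis by simp
qed

text \<open>The multipliers drop out whatever their sign, because each form \<open>Chat U i\<close>
  vanishes on \<open>uset U\<close>.\<close>

lemma IA_cone_nonneg_uset:
  assumes "M - (\<Sum>i\<in>UNIV. \<gamma> i *\<^sub>R Chat U i) \<in> IA_cone U" "u \<in> uset U"
  shows "0 \<le> u \<bullet> (M *v u)"
  using IA_cone_copositive[OF assms(1), of u] assms(2)
  by (simp add: uset_def inner_diff_matrix inner_sum_matrix inner_scaleR_matrix)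

text \<open>The multiplier terms are left out so that objective and constraint matrices enter
  \<open>SOS2_iff_AS_cone\<close> in the same form.\<close>

abbreviation L_objective_matrix where
  "L_objective_matrix T lam Y \<equiv> lam *\<^sub>R outer last_unit last_unit
    - (1/2) *\<^sub>R (transpose (Dhat T) ** Y + transpose Y ** Dhat T)"

abbreviation Q_objective_matrix where
  "Q_objective_matrix d lam Q \<equiv> lam *\<^sub>R outer last_unit last_unit - (\<Sum>n\<in>UNIV. d $ n *\<^sub>R Q n)"

lemma inner_L_objective_matrix:
  assumes "u $ None = 1"
  shows "u \<bullet> (L_objective_matrix T lam Y *v u) = lam - (Dhat T *v u) \<bullet> (Y *v u)"
  by (simp only: bilinear_simps inner_axis inner_axis' assms inner_commute[of "Y *v u"]) simp

lemma inner_Q_objective_matrix: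
  assumes "u $ None = 1"
  shows "u \<bullet> (Q_objective_matrix d lam Q *v u) = lam - d \<bullet> (\<chi> n. u \<bullet> (Q n *v u))"
  by (simp only: bilinear_simps inner_axis inner_axis' assms) (simp add: inner_vec_def[of d])

lemma symmetric_L_objective_matrix: "symmetric (L_objective_matrix T lam Y)"
  using symmetric_add_transpose[of "transpose (Dhat T) ** Y"]
  by (intro symmetric_diff symmetric_scaleR symmetric_outer) (simp add: matrix_transpose_mul)

lemma symmetric_Q_objective_matrix:
  "(\<And>n. symmetric (Q n)) \<Longrightarrow> symmetric (Q_objective_matrix d lam Q)"
  by (intro symmetric_diff symmetric_scaleR symmetric_outer symmetric_sum)

lemma symmetric_Omega: "symmetric (Omega T j x Y)"
proof -
  have "Omega T j x Y = sym_part (outer (Theta T j *v x) last_unit + Lambda T j ** Y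
      - outer (Hhat T $ j) last_unit)"
    unfolding Omega_def sym_part_def
    by (simp add: transpose_add_distrib transpose_diff_distrib transpose_outer matrix_transpose_mul
        algebra_simps)
  then show ?thesis by (simp only: symmetric_sym_part)
qed

lemma symmetric_Gamma: "(\<And>n. symmetric (Q n)) \<Longrightarrow> symmetric (Gamma T B j x Q)"
proof -
  assume Q: "\<And>n. symmetric (Q n)"
  have "Gamma T B j x Q = sym_part (outer (Theta T j *v x) last_unit - outer (Hhat T $ j) last_unit)
      + (\<Sum>n\<in>UNIV. B $ j $ n *\<^sub>R Q n)"
    unfolding Gamma_def sym_part_def
    by (simp add: transpose_diff_distrib transpose_outer algebra_simps)
  then show ?thesis by (simp only: symmetric_add symmetric_sym_part symmetric_sum symmetric_scaleR Q)
qed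

lemma Z_L_le_PL_IA: "Z_L U T \<le> PL_value U T (IA_cone U)"
  unfolding PL_value_def
proof (rule Inf_greatest, clarify)
  fix x lam Y \<pi> \<alpha> \<beta>
  assume x: "x \<in> feas T" and \<pi>: "\<forall>j. 0 \<le> \<pi> j"
    and obj: "L_objective_matrix T lam Y + (\<Sum>i\<in>UNIV. \<alpha> i *\<^sub>R Chat U i) \<in> IA_cone U"
    and con: "\<forall>j. Omega T j x Y - \<pi> j *\<^sub>R outer last_unit last_unit
        - (\<Sum>i\<in>UNIV. \<beta> j i *\<^sub>R Chat U i) \<in> IA_cone U"
  show "Z_L U T \<le> ereal (cost T \<bullet> x + lam)"
    unfolding Z_L_def
  proof (rule policy_value_le[OF x])
    show "(*v) Y \<in> linear_policies" by (auto simp: linear_policies_def)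
  next
    fix u j assume u: "u \<in> uset U"
    then have "0 \<le> u \<bullet> ((Omega T j x Y - \<pi> j *\<^sub>R outer last_unit last_unit) *v u)"
      using IA_cone_nonneg_uset con by blast
    \<comment> \<open>On the slice the slack matrix contributes \<pi> j \<ge> 0, so removing it
      preserves the inequality.\<close>
    then show "0 \<le> (Afun T u *v x + Bfun T u *v (Y *v u) - hfun T u) $ j"
      using u \<pi>[rule_format, of j] inner_Omega[of u T j x Y]
      by (simp add: bilinear_simps inner_axis inner_axis' uset_def)
  next
    fix u assume u: "u \<in> uset U"
    \<comment> \<open>The objective adds its multipliers where the constraints subtract them; a
      change of sign lets the same lemma apply.\<close>
    have "L_objective_matrix T lam Y - (\<Sum>i\<in>UNIV. (- \<alpha> i) *\<^sub>R Chat U i) \<in> IA_cone U"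
      using obj by (simp add: sum_negf)
    then have "0 \<le> u \<bullet> (L_objective_matrix T lam Y *v u)"
      using u by (rule IA_cone_nonneg_uset)
    then show "dfun T u \<bullet> (Y *v u) \<le> lam"
      using u inner_L_objective_matrix[of u lam T Y] by (simp add: uset_def dfun_def)
  qed
qed

lemma Z_Q_le_PQ_IA:
  assumes "fixed_recourse U T d B"
  shows "Z_Q U T \<le> PQ_value U T d B (IA_cone U)"
  unfolding PQ_value_def
proof (rule Inf_greatest, clarify)
  fix x lam Q \<pi> \<alpha> \<beta>
  assume x: "x \<in> feas T" and Q: "\<forall>n. symmetric (Q n)" and \<pi>: "\<forall>j. 0 \<le> \<pi> j"
    and obj: "Q_objective_matrix d lam Q + (\<Sum>i\<in>UNIV. \<alpha> i *\<^sub>R Chat U i) \<in> IA_cone U"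
    and con: "\<forall>j. Gamma T B j x Q - \<pi> j *\<^sub>R outer last_unit last_unit
        - (\<Sum>i\<in>UNIV. \<beta> j i *\<^sub>R Chat U i) \<in> IA_cone U"
  show "Z_Q U T \<le> ereal (cost T \<bullet> x + lam)"
    unfolding Z_Q_def
  proof (rule policy_value_le[OF x])
    show "(\<lambda>u. \<chi> n. u \<bullet> (Q n *v u)) \<in> quadratic_policies"
      using Q by (auto simp: quadratic_policies_def)
  next
    fix u j assume u: "u \<in> uset U"
    then have "0 \<le> u \<bullet> ((Gamma T B j x Q - \<pi> j *\<^sub>R outer last_unit last_unit) *v u)"
      using IA_cone_nonneg_uset con by blast
    then show "0 \<le> (Afun T u *v x + Bfun T u *v (\<chi> n. u \<bullet> (Q n *v u)) - hfun T u) $ j"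
      using u \<pi>[rule_format, of j] inner_Gamma[of u T B j x Q] assms
      by (simp add: bilinear_simps inner_axis inner_axis' uset_def fixed_recourse_def)
  next
    fix u assume u: "u \<in> uset U"
    have "Q_objective_matrix d lam Q - (\<Sum>i\<in>UNIV. (- \<alpha> i) *\<^sub>R Chat U i) \<in> IA_cone U"
      using obj by (simp add: sum_negf)
    then have "0 \<le> u \<bullet> (Q_objective_matrix d lam Q *v u)"
      using u by (rule IA_cone_nonneg_uset)
    then show "dfun T u \<bullet> (\<chi> n. u \<bullet> (Q n *v u)) \<le> lam"
      using u assms inner_Q_objective_matrix[of u lam d Q] by (simp add: uset_def fixed_recourse_def)
  qed
qed

lemma PL_value_antimono: "\<C> \<subseteq> \<C>' \<Longrightarrow> PL_value U T \<C>' \<le> PL_value U T \<C>"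
  unfolding PL_value_def by (rule Inf_superset_mono) blast

lemma PQ_value_antimono: "\<C> \<subseteq> \<C>' \<Longrightarrow> PQ_value U T d B \<C>' \<le> PQ_value U T d B \<C>"
  unfolding PQ_value_def by (rule Inf_superset_mono) blast

section \<open>Conic constraints as sum-of-squares conditions\<close>

lemma AS_cone_add_psd:
  assumes "V \<in> AS_cone U" "psd W"
  shows "V + W \<in> AS_cone U"
proof -
  from assms(1) obtain W' \<tau> \<theta> where "psd W'" "0 \<le> \<tau>" "\<forall>l. 0 \<le> \<theta> $ l"
    "V = W' + \<tau> *\<^sub>R Shat U + (1/2) *\<^sub>R (outer (transpose (Phat U) *v \<theta>) last_unit
           + outer last_unit (transpose (Phat U) *v \<theta>))"
    unfolding AS_cone_def by blast
  then show ?thesis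
    unfolding AS_cone_def mem_Collect_eq using assms(2)
    by (intro exI[of _ "W' + W"] exI[of _ \<tau>] exI[of _ \<theta>]) (simp add: psd_add)
qed

text \<open>\<open>SOS2\<close> has no counterpart of the slacks and quantifies its multipliers for
  each requirement separately; this brings the conic constraints to that shape. Zero slacks give the
  converse.\<close>

lemma AS_cone_absorb_slack:
  "(\<exists>\<pi> \<beta>. (\<forall>j. 0 \<le> \<pi> j) \<and>
      (\<forall>j. M j - \<pi> j *\<^sub>R outer last_unit last_unit - (\<Sum>i\<in>UNIV. \<beta> j i *\<^sub>R Chat U i) \<in> AS_cone U))
   \<longleftrightarrow> (\<forall>j. \<exists>\<gamma>. M j - (\<Sum>i\<in>UNIV. \<gamma> i *\<^sub>R Chat U i) \<in> AS_cone U)"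
    (is "?L \<longleftrightarrow> ?R")
proof
  assume ?L
  then obtain \<pi> \<beta> where \<pi>: "\<forall>j. (0::real) \<le> \<pi> j" and
    M: "\<forall>j. M j - \<pi> j *\<^sub>R outer last_unit last_unit - (\<Sum>i\<in>UNIV. \<beta> j i *\<^sub>R Chat U i) \<in> AS_cone U"
    by blast
  show ?R
  proof
    fix j
    have "psd (\<pi> j *\<^sub>R outer last_unit last_unit)" using \<pi> by (simp add: psd_scaleR psd_outer)
    from AS_cone_add_psd[OF M[rule_format, of j] this]
    show "\<exists>\<gamma>. M j - (\<Sum>i\<in>UNIV. \<gamma> i *\<^sub>R Chat U i) \<in> AS_cone U"
      by (intro exI[of _ "\<beta> j"]) (simp add: algebra_simps)
  qed
next
  assume ?R
  then obtain \<beta> where "\<forall>j. M j - (\<Sum>i\<in>UNIV. \<beta> j i *\<^sub>R Chat U i) \<in> AS_cone U" by metis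
  then show ?L by (intro exI[of _ "\<lambda>_. 0"] exI[of _ \<beta>]) simp
qed

lemma ex_uminus_multipliers:
  "(\<exists>\<alpha> :: 'i \<Rightarrow> real. M + (\<Sum>i\<in>UNIV. \<alpha> i *\<^sub>R A i) \<in> \<C>) \<longleftrightarrow> (\<exists>\<gamma>. M - (\<Sum>i\<in>UNIV. \<gamma> i *\<^sub>R A i) \<in> \<C>)"
  for M :: "real ^ 'n ^ 'm"
proof
  assume "\<exists>\<alpha>. M + (\<Sum>i\<in>UNIV. \<alpha> i *\<^sub>R A i) \<in> \<C>"
  then obtain \<alpha> where "M + (\<Sum>i\<in>UNIV. \<alpha> i *\<^sub>R A i) \<in> \<C>" ..
  then show "\<exists>\<gamma>. M - (\<Sum>i\<in>UNIV. \<gamma> i *\<^sub>R A i) \<in> \<C>"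
    by (intro exI[of _ "\<lambda>i. - \<alpha> i"]) (simp add: sum_negf)
next
  assume "\<exists>\<gamma>. M - (\<Sum>i\<in>UNIV. \<gamma> i *\<^sub>R A i) \<in> \<C>"
  then obtain \<gamma> where "M - (\<Sum>i\<in>UNIV. \<gamma> i *\<^sub>R A i) \<in> \<C>" ..
  then show "\<exists>\<alpha>. M + (\<Sum>i\<in>UNIV. \<alpha> i *\<^sub>R A i) \<in> \<C>"
    by (intro exI[of _ "\<lambda>i. - \<gamma> i"]) (simp add: sum_negf)
qed

lemma peval_first_stage_poly:
  assumes "u $ None = 1"
  shows "peval u (first_stage_poly T x j) = (Afun T u *v x - hfun T u) $ j"
proof -
  have "(\<Sum>m\<in>UNIV. ((\<chi> k. Ahat T k $ j $ m) \<bullet> u) * x $ m) = (Afun T u *v x) $ j"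
    by (simp add: Afun_def matrix_vector_mult_def inner_vec_def mult.commute)
  then show ?thesis
    using assms by (simp add: first_stage_poly_def peval_simps hfun_def matrix_mult_dot)
qed

lemma degree_le_first_stage_poly: "degree_le 2 (first_stage_poly T x j)"
  unfolding first_stage_poly_def
  by (subst mult.commute) (intro degree_le_intros)

text \<open>An equation ties y to the rows of Y instead of a substitution, so the equivalence serves
  both for rules built from Y and for rules whose coefficients come from a degree bound.\<close>

lemma SOS2_iff_L:
  fixes U :: "('k::finite, 'p::finite, 'r::{finite,linorder}, 'i::finite) uncertainty"
  assumes C: "\<And>i. symmetric (Chat U i)" and y: "\<And>n. y n = lin_poly (Y $ n)"
  shows "SOS2 U (Const lam - (\<Sum>n\<in>UNIV. lin_poly (Dhat T $ n) * y n))
      \<longleftrightarrow> (\<exists>\<gamma>. L_objective_matrix T lam Y - (\<Sum>i\<in>UNIV. \<gamma> i *\<^sub>R Chat U i) \<in> AS_cone U)"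
    and "SOS2 U (first_stage_poly T x j + (\<Sum>n\<in>UNIV. lin_poly (\<chi> k. Bhat T k $ j $ n) * y n))
      \<longleftrightarrow> (\<exists>\<gamma>. Omega T j x Y - (\<Sum>i\<in>UNIV. \<gamma> i *\<^sub>R Chat U i) \<in> AS_cone U)"
proof -
  show "SOS2 U (Const lam - (\<Sum>n\<in>UNIV. lin_poly (Dhat T $ n) * y n))
      \<longleftrightarrow> (\<exists>\<gamma>. L_objective_matrix T lam Y - (\<Sum>i\<in>UNIV. \<gamma> i *\<^sub>R Chat U i) \<in> AS_cone U)"
  proof (rule SOS2_iff_AS_cone[OF C symmetric_L_objective_matrix])
    show "degree_le 2 (Const lam - (\<Sum>n\<in>UNIV. lin_poly (Dhat T $ n) * y n))"
      unfolding y by (intro degree_le_intros degree_le_lin_poly)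
    fix u :: "real ^ 'k option" assume "u $ None = 1"
    then show "peval u (Const lam - (\<Sum>n\<in>UNIV. lin_poly (Dhat T $ n) * y n))
        = u \<bullet> (L_objective_matrix T lam Y *v u)"
      unfolding inner_L_objective_matrix[OF \<open>u $ None = 1\<close>]
      by (simp add: y peval_simps inner_vec_def[of "vec_lambda _"] matrix_mult_dot)
  qed
next
  show "SOS2 U (first_stage_poly T x j + (\<Sum>n\<in>UNIV. lin_poly (\<chi> k. Bhat T k $ j $ n) * y n))
      \<longleftrightarrow> (\<exists>\<gamma>. Omega T j x Y - (\<Sum>i\<in>UNIV. \<gamma> i *\<^sub>R Chat U i) \<in> AS_cone U)"
  proof (rule SOS2_iff_AS_cone[OF C symmetric_Omega])
    show "degree_le 2 (first_stage_poly T x j + (\<Sum>n\<in>UNIV. lin_poly (\<chi> k. Bhat T k $ j $ n) * y n))"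
      unfolding y by (intro degree_le_intros degree_le_lin_poly degree_le_first_stage_poly)
    fix u :: "real ^ 'k option" assume u: "u $ None = 1"
    have "(\<Sum>n\<in>UNIV. ((\<chi> k. Bhat T k $ j $ n) \<bullet> u) * (Y $ n \<bullet> u)) = (Bfun T u *v (Y *v u)) $ j"
      by (simp add: Defs.Bfun_def matrix_vector_mult_def inner_vec_def mult.commute)
    then show "peval u (first_stage_poly T x j + (\<Sum>n\<in>UNIV. lin_poly (\<chi> k. Bhat T k $ j $ n) * y n))
        = u \<bullet> (Omega T j x Y *v u)"
      unfolding inner_Omega[OF u] using u
      by (simp add: y peval_simps peval_first_stage_poly)
  qed
qed

text \<open>Constant recourse coefficients keep the products with rules of degree 2 within degree
  2.\<close>

lemma SOS2_iff_Q:
  fixes U :: "('k::finite, 'p::finite, 'r::{finite,linorder}, 'i::finite) uncertainty"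
  assumes C: "\<And>i. symmetric (Chat U i)" and Q: "\<And>n. symmetric (Q n)"
    and y: "\<And>n. y n = quad_poly (Q n)"
  shows "SOS2 U (Const lam - (\<Sum>n\<in>UNIV. Const (d $ n) * y n))
      \<longleftrightarrow> (\<exists>\<gamma>. Q_objective_matrix d lam Q - (\<Sum>i\<in>UNIV. \<gamma> i *\<^sub>R Chat U i) \<in> AS_cone U)"
    and "SOS2 U (first_stage_poly T x j + (\<Sum>n\<in>UNIV. Const (B $ j $ n) * y n))
      \<longleftrightarrow> (\<exists>\<gamma>. Gamma T B j x Q - (\<Sum>i\<in>UNIV. \<gamma> i *\<^sub>R Chat U i) \<in> AS_cone U)"
proof -
  show "SOS2 U (Const lam - (\<Sum>n\<in>UNIV. Const (d $ n) * y n))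
      \<longleftrightarrow> (\<exists>\<gamma>. Q_objective_matrix d lam Q - (\<Sum>i\<in>UNIV. \<gamma> i *\<^sub>R Chat U i) \<in> AS_cone U)"
  proof (rule SOS2_iff_AS_cone[OF C symmetric_Q_objective_matrix[OF Q]])
    show "degree_le 2 (Const lam - (\<Sum>n\<in>UNIV. Const (d $ n) * y n))"
      unfolding y by (intro degree_le_intros)
    fix u :: "real ^ 'k option" assume "u $ None = 1"
    then show "peval u (Const lam - (\<Sum>n\<in>UNIV. Const (d $ n) * y n))
        = u \<bullet> (Q_objective_matrix d lam Q *v u)"
      unfolding inner_Q_objective_matrix[OF \<open>u $ None = 1\<close>]
      by (simp add: y peval_simps inner_vec_def[of d])
  qed
next
  show "SOS2 U (first_stage_poly T x j + (\<Sum>n\<in>UNIV. Const (B $ j $ n) * y n))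
      \<longleftrightarrow> (\<exists>\<gamma>. Gamma T B j x Q - (\<Sum>i\<in>UNIV. \<gamma> i *\<^sub>R Chat U i) \<in> AS_cone U)"
  proof (rule SOS2_iff_AS_cone[OF C symmetric_Gamma[OF Q]])
    show "degree_le 2 (first_stage_poly T x j + (\<Sum>n\<in>UNIV. Const (B $ j $ n) * y n))"
      unfolding y by (intro degree_le_intros degree_le_first_stage_poly)
    fix u :: "real ^ 'k option" assume u: "u $ None = 1"
    show "peval u (first_stage_poly T x j + (\<Sum>n\<in>UNIV. Const (B $ j $ n) * y n))
        = u \<bullet> (Gamma T B j x Q *v u)"
      unfolding inner_Gamma[OF u] using u
      by (simp add: y peval_simps peval_first_stage_poly matrix_vector_mult_def[of B])
  qed
qed

text \<open>The feasible pairs of \<open>x\<close> and \<open>lam\<close> coincide, so both infima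
  range over one set.\<close>

lemma PL_AS_eq_Z_SOS_P1:
  fixes U :: "('k::finite, 'p::finite, 'r::{finite,linorder}, 'i::finite) uncertainty"
    and T :: "('k, 'm::finite, 'n::finite, 'j::finite) two_stage"
  assumes C: "\<And>i. symmetric (Chat U i)"
  shows "PL_value U T (AS_cone U) = Z_SOS_P1 U T"
proof -
  have "(\<exists>(Y :: real ^ 'k option ^ 'n) \<pi> \<alpha> \<beta>. x \<in> feas T \<and> (\<forall>j. 0 \<le> \<pi> j) \<and>
      L_objective_matrix T lam Y + (\<Sum>i\<in>UNIV. \<alpha> i *\<^sub>R Chat U i) \<in> AS_cone U \<and>
      (\<forall>j. Omega T j x Y - \<pi> j *\<^sub>R outer last_unit last_unit
        - (\<Sum>i\<in>UNIV. \<beta> j i *\<^sub>R Chat U i) \<in> AS_cone U))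
    \<longleftrightarrow> (\<exists>y. x \<in> feas T \<and> (\<forall>n. degree_le 1 (y n)) \<and>
      SOS2 U (Const lam - (\<Sum>n\<in>UNIV. lin_poly (Dhat T $ n) * y n)) \<and>
      (\<forall>j. SOS2 U (first_stage_poly T x j
              + (\<Sum>n\<in>UNIV. lin_poly (\<chi> k. Bhat T k $ j $ n) * y n))))" (is "?L \<longleftrightarrow> ?R") for x lam
  proof -
    let ?S = "\<lambda>Y :: real ^ 'k option ^ 'n. x \<in> feas T \<and>
      (\<exists>\<gamma>. L_objective_matrix T lam Y - (\<Sum>i\<in>UNIV. \<gamma> i *\<^sub>R Chat U i) \<in> AS_cone U) \<and>
      (\<forall>j. \<exists>\<gamma>. Omega T j x Y - (\<Sum>i\<in>UNIV. \<gamma> i *\<^sub>R Chat U i) \<in> AS_cone U)"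
    \<comment> \<open>Reading both equivalences from right to left restores slacks and added
      multipliers, after which only quantifiers must be rearranged.\<close>
    have "?L \<longleftrightarrow> (\<exists>Y. ?S Y)"
      unfolding AS_cone_absorb_slack[symmetric] unfolding ex_uminus_multipliers[symmetric] by blast
    also have "\<dots> \<longleftrightarrow> ?R"
    proof
      assume "\<exists>Y. ?S Y"
      then obtain Y where "?S Y" ..
      then show ?R
        by (intro exI[of _ "\<lambda>n. lin_poly (Y $ n)"])
          (simp add: SOS2_iff_L[OF C refl] degree_le_lin_poly[unfolded One_nat_def])
    next
      assume ?R
      then obtain y where y: "x \<in> feas T" "\<forall>n. degree_le 1 (y n)"
        "SOS2 U (Const lam - (\<Sum>n\<in>UNIV. lin_poly (Dhat T $ n) * y n))"
        "\<forall>j. SOS2 U (first_stage_poly T x j + (\<Sum>n\<in>UNIV. lin_poly (\<chi> k. Bhat T k $ j $ n) * y n))"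
        by blast
      have "\<exists>a. y n = lin_poly a" for n
        using y(2) degree_le_1_imp_lin_poly[of "y n"] by blast
      then obtain f where f: "\<And>n. y n = lin_poly (f n)" by metis
      \<comment> \<open>The coefficient vectors are collected as the rows of one matrix, the shape
        that \<open>SOS2_iff_L\<close> expects.\<close>
      have eq: "y n = lin_poly ((\<chi> n. f n) $ n)" for n unfolding vec_lambda_beta by (rule f)
      show "\<exists>Y. ?S Y"
        using y(1,3,4) unfolding SOS2_iff_L[OF C eq] by blast
    qed
    finally show ?thesis .
  qed
  then have "{ereal (cost T \<bullet> x + lam) | x lam (Y :: real ^ 'k option ^ 'n) \<pi> \<alpha> \<beta>.
      x \<in> feas T \<and> (\<forall>j. 0 \<le> \<pi> j) \<and>
      L_objective_matrix T lam Y + (\<Sum>i\<in>UNIV. \<alpha> i *\<^sub>R Chat U i) \<in> AS_cone U \<and>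
      (\<forall>j. Omega T j x Y - \<pi> j *\<^sub>R outer last_unit last_unit
        - (\<Sum>i\<in>UNIV. \<beta> j i *\<^sub>R Chat U i) \<in> AS_cone U)}
    = {ereal (cost T \<bullet> x + lam) | x lam y.
      x \<in> feas T \<and> (\<forall>n. degree_le 1 (y n)) \<and>
      SOS2 U (Const lam - (\<Sum>n\<in>UNIV. lin_poly (Dhat T $ n) * y n)) \<and>
      (\<forall>j. SOS2 U (first_stage_poly T x j
              + (\<Sum>n\<in>UNIV. lin_poly (\<chi> k. Bhat T k $ j $ n) * y n)))}"
    by (intro Collect_cong) (simp only: ex_simps simp_thms)
  then show ?thesis unfolding PL_value_def Z_SOS_P1_def by (rule arg_cong)
qed

lemma PQ_AS_eq_Z_SOS_P2:
  fixes U :: "('k::finite, 'p::finite, 'r::{finite,linorder}, 'i::finite) uncertainty"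
    and T :: "('k, 'm::finite, 'n::finite, 'j::finite) two_stage"
  assumes C: "\<And>i. symmetric (Chat U i)"
  shows "PQ_value U T d B (AS_cone U) = Z_SOS_P2 U T d B"
proof -
  have "(\<exists>Q \<pi> \<alpha> \<beta>. x \<in> feas T \<and> (\<forall>n. symmetric (Q n)) \<and> (\<forall>j. 0 \<le> \<pi> j) \<and>
      Q_objective_matrix d lam Q + (\<Sum>i\<in>UNIV. \<alpha> i *\<^sub>R Chat U i) \<in> AS_cone U \<and>
      (\<forall>j. Gamma T B j x Q - \<pi> j *\<^sub>R outer last_unit last_unit
        - (\<Sum>i\<in>UNIV. \<beta> j i *\<^sub>R Chat U i) \<in> AS_cone U))
    \<longleftrightarrow> (\<exists>y. x \<in> feas T \<and> (\<forall>n. degree_le 2 (y n)) \<and>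
      SOS2 U (Const lam - (\<Sum>n\<in>UNIV. Const (d $ n) * y n)) \<and>
      (\<forall>j. SOS2 U (first_stage_poly T x j + (\<Sum>n\<in>UNIV. Const (B $ j $ n) * y n))))"
    (is "?L \<longleftrightarrow> ?R") for x lam
  proof -
    let ?S = "\<lambda>Q. x \<in> feas T \<and> (\<forall>n. symmetric (Q n)) \<and>
      (\<exists>\<gamma>. Q_objective_matrix d lam Q - (\<Sum>i\<in>UNIV. \<gamma> i *\<^sub>R Chat U i) \<in> AS_cone U) \<and>
      (\<forall>j. \<exists>\<gamma>. Gamma T B j x Q - (\<Sum>i\<in>UNIV. \<gamma> i *\<^sub>R Chat U i) \<in> AS_cone U)"
    have "?L \<longleftrightarrow> (\<exists>Q. ?S Q)"
      unfolding AS_cone_absorb_slack[symmetric] unfolding ex_uminus_multipliers[symmetric] by blast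
    also have "\<dots> \<longleftrightarrow> ?R"
    proof
      assume "\<exists>Q. ?S Q"
      then obtain Q where Q: "\<And>n. symmetric (Q n)" and "?S Q" by blast
      then show ?R
        by (intro exI[of _ "\<lambda>n. quad_poly (Q n)"]) (simp add: SOS2_iff_Q[OF C Q refl] degree_le_quad_poly)
    next
      assume ?R
      then obtain y where y: "x \<in> feas T" "\<forall>n. degree_le 2 (y n)"
        "SOS2 U (Const lam - (\<Sum>n\<in>UNIV. Const (d $ n) * y n))"
        "\<forall>j. SOS2 U (first_stage_poly T x j + (\<Sum>n\<in>UNIV. Const (B $ j $ n) * y n))"
        by blast
      from y(2) have "\<forall>n. \<exists>M. symmetric M \<and> y n = quad_poly M"
        by (metis degree_le_2_imp_quad_poly)
      then obtain Q where Q: "\<And>n. symmetric (Q n)" and eq: "\<And>n. y n = quad_poly (Q n)" by metis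
      show "\<exists>Q. ?S Q"
        using y(1,3,4) Q unfolding SOS2_iff_Q[OF C Q eq] by blast
    qed
    finally show ?thesis .
  qed
  then have "{ereal (cost T \<bullet> x + lam) | x lam Q \<pi> \<alpha> \<beta>.
      x \<in> feas T \<and> (\<forall>n. symmetric (Q n)) \<and> (\<forall>j. 0 \<le> \<pi> j) \<and>
      Q_objective_matrix d lam Q + (\<Sum>i\<in>UNIV. \<alpha> i *\<^sub>R Chat U i) \<in> AS_cone U \<and>
      (\<forall>j. Gamma T B j x Q - \<pi> j *\<^sub>R outer last_unit last_unit
        - (\<Sum>i\<in>UNIV. \<beta> j i *\<^sub>R Chat U i) \<in> AS_cone U)}
    = {ereal (cost T \<bullet> x + lam) | x lam y.
      x \<in> feas T \<and> (\<forall>n. degree_le 2 (y n)) \<and>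
      SOS2 U (Const lam - (\<Sum>n\<in>UNIV. Const (d $ n) * y n)) \<and>
      (\<forall>j. SOS2 U (first_stage_poly T x j + (\<Sum>n\<in>UNIV. Const (B $ j $ n) * y n)))}"
    by (intro Collect_cong) (simp only: ex_simps simp_thms)
  then show ?thesis unfolding PQ_value_def Z_SOS_P2_def by (rule arg_cong)
qed

theorem theorem4:
  fixes U :: "('k::finite, 'p::finite, 'r::{finite,linorder}, 'i::finite) uncertainty"
    and T :: "('k, 'm::finite, 'n::finite, 'j::finite) two_stage"
  assumes C_symmetric: "\<And>i. symmetric (Chat U i)"
    and A1: "assumption_A1 U"
    and A2: "assumption_A2 U"
    and last_nonneg: "\<And>u. (\<forall>l. 0 \<le> (Phat U *v u) $ l) \<Longrightarrow> Rhat U *v u \<in> SOC \<Longrightarrow> 0 \<le> u $ None"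
  shows "(Z_L U T \<le> PL_value U T (IA_cone U) \<and>
          PL_value U T (IA_cone U) \<le> PL_value U T (AS_cone U) \<and>
          PL_value U T (AS_cone U) = Z_SOS_P1 U T) \<and>
         (\<forall>d B. fixed_recourse U T d B \<longrightarrow>
            Z_Q U T \<le> PQ_value U T d B (IA_cone U) \<and>
            PQ_value U T d B (IA_cone U) \<le> PQ_value U T d B (AS_cone U) \<and>
            PQ_value U T d B (AS_cone U) = Z_SOS_P2 U T d B)"
proof -
  have "AS_cone U \<subseteq> IA_cone U"
    by (rule AS_cone_subset_IA_cone[OF A1 last_nonneg])
  then show ?thesis
    by (simp add: Z_L_le_PL_IA Z_Q_le_PQ_IA PL_value_antimono PQ_value_antimono
        flip: PL_AS_eq_Z_SOS_P1[OF C_symmetric] PQ_AS_eq_Z_SOS_P2[OF C_symmetric])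
qed

end
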